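(* Let $\mathscr{C}$ be an abelian Krull–Schmidt category with enough projective objects. For any set $\mathcal{X}$ of (isomorphism classes of) non-projective indecomposable objects of $\mathscr{C}$, with $(\mathcal{X}^i)_{i\ge 0}$ the sequence of sets of indecomposable objects defined in the context, one has $$\operatorname{Res}(\mathcal{X})=\operatorname{add}\Big(\bigcup_{i\ge 0}\mathcal{X}^i\Big),$$ and the set $\mathcal{X}^{\operatorname{Res}}$ of non-projective indecomposable objects of $\operatorname{Res}(\mathcal{X})$ equals $\big(\bigcup_{i\ge 0}\mathcal{X}^i\big)\setminus\operatorname{proj}(\mathscr{C})$.
   Context: $\operatorname{add}(\mathcal{Y})$ is the smallest full subcategory of $\mathscr{C}$ containing $\mathcal{Y}$ and closed under finite direct sums and direct summands. $\operatorname{proj}(\mathscr{C})$ is the subcategory of projective objects. A full subcategory is resolving if it is closed under direct sums and direct summands, every object of $\mathscr{C}$ is a quotient of an object in it, and it is closed under extensions and under kernels of epimorphisms. $\operatorname{Res}(\mathcal{X})$ is the smallest resolving subcategory containing $\mathcal{X}$. The sets $\mathcal{X}^i$ (of isomorphism classes of indecomposable objects) are defined inductively. $\mathcal{X}^0=\mathcal{X}\cup\{\text{indecomposable projective objects of }\mathscr{C}\}$. Given $\mathcal{X}^i$, the set $\mathcal{X}^{i+1}$ is the union of $\mathcal{X}^i$ and of all indecomposable direct summands of objects $Y\in\mathscr{C}$ appearing either (a) in a short exact sequence $0\to A\to Y\to B\to 0$ with $A,B\in\mathcal{X}^i$, or (b) in a short exact sequence $0\to Y\to \bigoplus_{k=0}^p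 A_k\to B\to 0$ for some integer $p\ge 1$ with $B,A_0,\dots,A_p\in\mathcal{X}^i$. *)

theory Defs
  imports "HOL-Algebra.Ring"
begin

text \<open>
  A category is given by a set of objects and a set of arrows, with composition written in the
  usual order: \<open>Comp C g f\<close> is ``first \<open>f\<close>, then \<open>g\<close>''. The preadditive structure is part of
  the data. The operations are total HOL functions, meaningful only on suitable arguments.
\<close>

record ('o, 'm) precat =
  Ob :: "'o set"
  Arr :: "'m set"
  Dom :: "'m \<Rightarrow> 'o"
  Cod :: "'m \<Rightarrow> 'o"
  Id :: "'o \<Rightarrow> 'm"
  Comp :: "'m \<Rightarrow> 'm \<Rightarrow> 'm"  (infixl "\<cdot>\<index>" 70)
  Add :: "'m \<Rightarrow> 'm \<Rightarrow> 'm"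
  Zero :: "'o \<Rightarrow> 'o \<Rightarrow> 'm"

definition Hom :: "('o, 'm) precat \<Rightarrow> 'o \<Rightarrow> 'o \<Rightarrow> 'm set" where
  "Hom C A B = {f \<in> Arr C. Dom C f = A \<and> Cod C f = B}"

definition hom_group :: "('o, 'm) precat \<Rightarrow> 'o \<Rightarrow> 'o \<Rightarrow> 'm monoid" where
  "hom_group C A B = \<lparr>carrier = Hom C A B, mult = Add C, one = Zero C A B\<rparr>"

definition end_ring :: "('o, 'm) precat \<Rightarrow> 'o \<Rightarrow> 'm ring" where
  "end_ring C A = \<lparr>carrier = Hom C A A, mult = Comp C, one = Id C A,
                   zero = Zero C A A, add = Add C\<rparr>"


section \<open>Categories and preadditive categories\<close>

locale category =
  fixes C :: "('o, 'm) precat" (structure)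
  assumes Dom_closed: "f \<in> Arr C \<Longrightarrow> Dom C f \<in> Ob C"
    and Cod_closed: "f \<in> Arr C \<Longrightarrow> Cod C f \<in> Ob C"
    and Id_closed: "A \<in> Ob C \<Longrightarrow> Id C A \<in> Hom C A A"
    and Comp_closed: "f \<in> Hom C A B \<Longrightarrow> g \<in> Hom C B D \<Longrightarrow> g \<cdot> f \<in> Hom C A D"
    and Id_left: "f \<in> Hom C A B \<Longrightarrow> Id C B \<cdot> f = f"
    and Id_right: "f \<in> Hom C A B \<Longrightarrow> f \<cdot> Id C A = f"
    and Comp_assoc: "f \<in> Hom C A B \<Longrightarrow> g \<in> Hom C B D \<Longrightarrow> h \<in> Hom C D E
           \<Longrightarrow> h \<cdot> g \<cdot> f = h \<cdot> (g \<cdot> f)"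

locale preadditive_category = category +
  assumes hom_comm_group: "A \<in> Ob C \<Longrightarrow> B \<in> Ob C \<Longrightarrow> comm_group (hom_group C A B)"
    and Comp_Add_left: "f \<in> Hom C A B \<Longrightarrow> g \<in> Hom C B D \<Longrightarrow> h \<in> Hom C B D
           \<Longrightarrow> Add C g h \<cdot> f = Add C (g \<cdot> f) (h \<cdot> f)"
    and Comp_Add_right: "f \<in> Hom C A B \<Longrightarrow> g \<in> Hom C A B \<Longrightarrow> h \<in> Hom C B D
           \<Longrightarrow> h \<cdot> Add C f g = Add C (h \<cdot> f) (h \<cdot> g)"


section \<open>Objects and morphisms\<close>

definition isomorphic :: "('o, 'm) precat \<Rightarrow> 'o \<Rightarrow> 'o \<Rightarrow> bool" where
  "isomorphic C A B \<longleftrightarrow> A \<in> Ob C \<and> B \<in> Ob C \<and>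
     (\<exists>f \<in> Hom C A B. \<exists>g \<in> Hom C B A. Comp C g f = Id C A \<and> Comp C f g = Id C B)"

definition iso_class :: "('o, 'm) precat \<Rightarrow> 'o \<Rightarrow> 'o set" where
  "iso_class C A = {B \<in> Ob C. isomorphic C A B}"

definition zero_object :: "('o, 'm) precat \<Rightarrow> 'o \<Rightarrow> bool" where
  "zero_object C Z \<longleftrightarrow> Z \<in> Ob C \<and>
     (\<forall>A \<in> Ob C. (\<exists>!f. f \<in> Hom C Z A) \<and> (\<exists>!f. f \<in> Hom C A Z))"

definition monic :: "('o, 'm) precat \<Rightarrow> 'm \<Rightarrow> bool" where
  "monic C f \<longleftrightarrow> f \<in> Arr C \<and>
     (\<forall>T \<in> Ob C. \<forall>g \<in> Hom C T (Dom C f). \<forall>h \<in> Hom C T (Dom C f).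
        Comp C f g = Comp C f h \<longrightarrow> g = h)"

definition epic :: "('o, 'm) precat \<Rightarrow> 'm \<Rightarrow> bool" where
  "epic C f \<longleftrightarrow> f \<in> Arr C \<and>
     (\<forall>T \<in> Ob C. \<forall>g \<in> Hom C (Cod C f) T. \<forall>h \<in> Hom C (Cod C f) T.
        Comp C g f = Comp C h f \<longrightarrow> g = h)"

definition is_kernel :: "('o, 'm) precat \<Rightarrow> 'm \<Rightarrow> 'm \<Rightarrow> bool" where
  "is_kernel C k f \<longleftrightarrow> k \<in> Arr C \<and> f \<in> Arr C \<and> Cod C k = Dom C f \<and>
     Comp C f k = Zero C (Dom C k) (Cod C f) \<and>
     (\<forall>T \<in> Ob C. \<forall>t \<in> Hom C T (Dom C f). Comp C f t = Zero C T (Cod C f) \<longrightarrow>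
        (\<exists>!h. h \<in> Hom C T (Dom C k) \<and> Comp C k h = t))"

definition is_cokernel :: "('o, 'm) precat \<Rightarrow> 'm \<Rightarrow> 'm \<Rightarrow> bool" where
  "is_cokernel C c f \<longleftrightarrow> c \<in> Arr C \<and> f \<in> Arr C \<and> Dom C c = Cod C f \<and>
     Comp C c f = Zero C (Dom C f) (Cod C c) \<and>
     (\<forall>T \<in> Ob C. \<forall>t \<in> Hom C (Cod C f) T. Comp C t f = Zero C (Dom C f) T \<longrightarrow>
        (\<exists>!h. h \<in> Hom C (Cod C c) T \<and> Comp C h c = t))"

text \<open>
  \<open>direct_sum C As S\<close>: the object \<open>S\<close> is a direct sum (biproduct) of the finite family \<open>As\<close>.
  The group operation of the hom groups is written multiplicatively in the library, so \<open>finprod\<close>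
  is the sum of the endomorphisms \<open>\<iota> k \<cdot> \<pi> k\<close>. A direct sum of the empty family is a
  zero object.
\<close>

definition direct_sum :: "('o, 'm) precat \<Rightarrow> 'o list \<Rightarrow> 'o \<Rightarrow> bool" where
  "direct_sum C As S \<longleftrightarrow> set As \<subseteq> Ob C \<and> S \<in> Ob C \<and>
     (\<exists>\<iota> \<pi>. (\<forall>k < length As. \<iota> k \<in> Hom C (As ! k) S \<and> \<pi> k \<in> Hom C S (As ! k)) \<and>
        (\<forall>j < length As. \<forall>k < length As.
           Comp C (\<pi> j) (\<iota> k) = (if j = k then Id C (As ! k) else Zero C (As ! k) (As ! j))) \<and>
        finprod (hom_group C S S) (\<lambda>k. Comp C (\<iota> k) (\<pi> k)) {..<length As} = Id C S)"

definition direct_summand :: "('o, 'm) precat \<Rightarrow> 'o \<Rightarrow> 'o \<Rightarrow> bool" where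
  "direct_summand C Z Y \<longleftrightarrow> (\<exists>W. direct_sum C [Z, W] Y)"

definition indecomposable :: "('o, 'm) precat \<Rightarrow> 'o \<Rightarrow> bool" where
  "indecomposable C M \<longleftrightarrow> M \<in> Ob C \<and> \<not> zero_object C M \<and>
     (\<forall>A B. direct_sum C [A, B] M \<longrightarrow> zero_object C A \<or> zero_object C B)"

definition short_exact :: "('o, 'm) precat \<Rightarrow> 'o \<Rightarrow> 'm \<Rightarrow> 'o \<Rightarrow> 'm \<Rightarrow> 'o \<Rightarrow> bool" where
  "short_exact C A f Y g B \<longleftrightarrow> f \<in> Hom C A Y \<and> g \<in> Hom C Y B \<and>
     is_kernel C f g \<and> is_cokernel C g f"

definition projective :: "('o, 'm) precat \<Rightarrow> 'o \<Rightarrow> bool" where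
  "projective C P \<longleftrightarrow> P \<in> Ob C \<and>
     (\<forall>g f. epic C g \<and> f \<in> Hom C P (Cod C g) \<longrightarrow>
        (\<exists>h \<in> Hom C P (Dom C g). Comp C g h = f))"

definition quotient_of :: "('o, 'm) precat \<Rightarrow> 'o \<Rightarrow> 'o \<Rightarrow> bool" where
  "quotient_of C M N \<longleftrightarrow> (\<exists>f \<in> Hom C N M. epic C f)"


section \<open>Abelian Krull--Schmidt categories with enough projectives\<close>

locale abelian_category = preadditive_category +
  assumes ex_zero_object: "\<exists>Z. zero_object C Z"
    and ex_direct_sum: "A \<in> Ob C \<Longrightarrow> B \<in> Ob C \<Longrightarrow> \<exists>S. direct_sum C [A, B] S"
    and ex_kernel: "f \<in> Arr C \<Longrightarrow> \<exists>k. is_kernel C k f"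
    and ex_cokernel: "f \<in> Arr C \<Longrightarrow> \<exists>c. is_cokernel C c f"
    and monic_is_kernel: "monic C f \<Longrightarrow> \<exists>g. is_kernel C f g"
    and epic_is_cokernel: "epic C f \<Longrightarrow> \<exists>g. is_cokernel C f g"

text \<open>Rings are not assumed commutative here; the non-units of a local ring are closed under sums.\<close>

definition local_ring :: "('a, 'b) ring_scheme \<Rightarrow> bool" where
  "local_ring R \<longleftrightarrow> ring R \<and> \<one>\<^bsub>R\<^esub> \<noteq> \<zero>\<^bsub>R\<^esub> \<and>
     (\<forall>x \<in> carrier R - Units R. \<forall>y \<in> carrier R - Units R. x \<oplus>\<^bsub>R\<^esub> y \<notin> Units R)"

definition krull_schmidt :: "('o, 'm) precat \<Rightarrow> bool" where
  "krull_schmidt C \<longleftrightarrow>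
     (\<forall>M \<in> Ob C. \<exists>As. direct_sum C As M \<and> (\<forall>A \<in> set As. local_ring (end_ring C A)))"

definition enough_projectives :: "('o, 'm) precat \<Rightarrow> bool" where
  "enough_projectives C \<longleftrightarrow> (\<forall>M \<in> Ob C. \<exists>P. projective C P \<and> quotient_of C M P)"


section \<open>Additive closures and resolving subcategories\<close>

text \<open>
  A full subcategory is identified with its set of objects. Closure under direct summands makes
  it closed under isomorphism. A set of isomorphism classes is a set \<open>\<Y>\<close> of sets of objects,
  and a full subcategory contains it iff it contains all the objects in \<open>\<Union>\<Y>\<close>.
\<close>

definition closed_direct_sums :: "('o, 'm) precat \<Rightarrow> 'o set \<Rightarrow> bool" where
  "closed_direct_sums C U \<longleftrightarrow> (\<forall>As S. set As \<subseteq> U \<and> direct_sum C As S \<longrightarrow> S \<in> U)"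

definition closed_direct_summands :: "('o, 'm) precat \<Rightarrow> 'o set \<Rightarrow> bool" where
  "closed_direct_summands C U \<longleftrightarrow> (\<forall>Z Y. Y \<in> U \<and> direct_summand C Z Y \<longrightarrow> Z \<in> U)"

definition closed_extensions :: "('o, 'm) precat \<Rightarrow> 'o set \<Rightarrow> bool" where
  "closed_extensions C U \<longleftrightarrow>
     (\<forall>A f Y g B. short_exact C A f Y g B \<and> A \<in> U \<and> B \<in> U \<longrightarrow> Y \<in> U)"

definition closed_kernels_of_epis :: "('o, 'm) precat \<Rightarrow> 'o set \<Rightarrow> bool" where
  "closed_kernels_of_epis C U \<longleftrightarrow>
     (\<forall>k f. epic C f \<and> Dom C f \<in> U \<and> Cod C f \<in> U \<and> is_kernel C k f \<longrightarrow> Dom C k \<in> U)"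

definition resolving :: "('o, 'm) precat \<Rightarrow> 'o set \<Rightarrow> bool" where
  "resolving C U \<longleftrightarrow> U \<subseteq> Ob C \<and> closed_direct_sums C U \<and> closed_direct_summands C U \<and>
     (\<forall>M \<in> Ob C. \<exists>N \<in> U. quotient_of C M N) \<and>
     closed_extensions C U \<and> closed_kernels_of_epis C U"

definition add_closure :: "('o, 'm) precat \<Rightarrow> 'o set set \<Rightarrow> 'o set" where
  "add_closure C \<Y> = (LEAST U. U \<subseteq> Ob C \<and> \<Union>\<Y> \<subseteq> U \<and> closed_direct_sums C U \<and> closed_direct_summands C U)"

definition Res :: "('o, 'm) precat \<Rightarrow> 'o set set \<Rightarrow> 'o set" where
  "Res C \<X> = (LEAST U. resolving C U \<and> \<Union>\<X> \<subseteq> U)"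


section \<open>The sets of isomorphism classes of indecomposable objects\<close>

definition proj :: "('o, 'm) precat \<Rightarrow> 'o set set" where
  "proj C = {iso_class C P | P. projective C P}"

fun level :: "('o, 'm) precat \<Rightarrow> 'o set set \<Rightarrow> nat \<Rightarrow> 'o set set" where
  "level C \<X> 0 = \<X> \<union> {iso_class C P | P. indecomposable C P \<and> projective C P}"
| "level C \<X> (Suc i) = level C \<X> i \<union>
     {iso_class C Z | Z Y. indecomposable C Z \<and> direct_summand C Z Y \<and>
        ((\<exists>A f g B. short_exact C A f Y g B \<and>
             iso_class C A \<in> level C \<X> i \<and> iso_class C B \<in> level C \<X> i) \<or>
         (\<exists>p \<ge> 1. \<exists>As S f g B. length As = p + 1 \<and> direct_sum C As S \<and>
             short_exact C Y f S g B \<and>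
             (\<forall>A \<in> set As. iso_class C A \<in> level C \<X> i) \<and> iso_class C B \<in> level C \<X> i))}"

text \<open>The isomorphism classes of non-projective indecomposable objects of a full subcategory.\<close>

definition nonproj_indec :: "('o, 'm) precat \<Rightarrow> 'o set \<Rightarrow> 'o set set" where
  "nonproj_indec C U = {iso_class C M | M. M \<in> U \<and> indecomposable C M \<and> \<not> projective C M}"

end

theory Submission
  imports Defs
begin

text \<open>
  Let \<open>E\<close> consist of the objects all of whose indecomposable summands have their class in
  \<open>\<Union>i. level C \<X> i\<close>. Since indecomposables have local endomorphism rings, \<open>E\<close> is the additive
  closure of that union, and it lies in every resolving subcategory containing \<open>\<X>\<close>; what has to be
  seen is that \<open>E\<close> is resolving.

  The kernel of an epimorphism \<open>A \<rightarrow> B\<^sub>1 \<oplus> B\<^sub>2\<close> is the kernel of an epimorphism \<open>X \<rightarrow> B\<^sub>2\<close>, where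
  \<open>X\<close> is the kernel of \<open>A \<rightarrow> B\<^sub>1\<close>, so closure under kernels reduces to indecomposable targets,
  which is step (b). Closure under extensions needs kernels: an extension \<open>Y\<close> of \<open>B\<close> by
  \<open>A\<^sub>1 \<oplus> A\<^sub>2\<close> is the fibre product over \<open>B\<close> of its pushouts \<open>Y\<^sub>1\<close>, \<open>Y\<^sub>2\<close>, that is, the kernel of an
  epimorphism \<open>Y\<^sub>1 \<oplus> Y\<^sub>2 \<rightarrow> B\<close>. This reduces to indecomposable \<open>A\<close>; decomposing \<open>B\<close> is then a plain
  filtration argument.
\<close>

section \<open>Arrows of a preadditive category\<close>

text \<open>Steps (a) and (b) allow only single indecomposables as end terms (\<open>A\<close> and
  \<open>B\<close> in (a), \<open>B\<close> in (b)), and this shapes the proof. If an extension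
  \<open>Y\<close> of \<open>B\<close> by \<open>A\<close> is filtered by a summand A1 of
  \<open>A\<close>, the quotient Y/A1 lies in the span but has an uncontrolled number of
  indecomposable summands, so an induction on the summands of \<open>A\<close> does not close. In
  the fibre product both pieces are extensions of the same \<open>B\<close> by smaller terms, and
  what remains is a kernel, for which closure is already known. On the side of \<open>B\<close> the
  difficulty is absent: the intermediate object only replaces the left-hand term, over which the
  induction ranges freely. Local endomorphism rings serve mainly to show that an indecomposable
  summand of a direct sum is a summand of one of its terms; this makes the span closed under direct
  sums. Most exactness claims are diagram chases with arrows \<open>t\<close> in the role of
  elements. A lift along an epimorphism exists only after the domain of \<open>t\<close> is refined
  by a further epimorphism, which the stability of epimorphisms under pullback supplies.\<close>

context category
begin

text \<open>The locale axioms mention intermediate objects that the simplifier cannot guess.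
  Expressed through \<open>Dom\<close> and \<open>Cod\<close>, the side conditions become equations
  that it can solve.\<close>

lemma Comp_arr [simp]:
  assumes "f \<in> Arr C" "g \<in> Arr C" "Dom C g = Cod C f"
  shows "g \<cdot> f \<in> Arr C" "Dom C (g \<cdot> f) = Dom C f" "Cod C (g \<cdot> f) = Cod C g"
  using Comp_closed[of f "Dom C f" "Cod C f" g "Cod C g"] assms by (auto simp: Hom_def)

lemma Id_arr [simp]:
  assumes "A \<in> Ob C"
  shows "Id C A \<in> Arr C" "Dom C (Id C A) = A" "Cod C (Id C A) = A"
  using Id_closed[OF assms] by (auto simp: Hom_def)

lemma Comp_Id_left [simp]: "f \<in> Arr C \<Longrightarrow> Cod C f = A \<Longrightarrow> Id C A \<cdot> f = f"
  using Id_left[of f "Dom C f" A] by (auto simp: Hom_def)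

lemma Comp_Id_right [simp]: "f \<in> Arr C \<Longrightarrow> Dom C f = A \<Longrightarrow> f \<cdot> Id C A = f"
  using Id_right[of f A "Cod C f"] by (auto simp: Hom_def)

lemma Comp_assoc' [simp]:
  assumes "f \<in> Arr C" "g \<in> Arr C" "h \<in> Arr C" "Dom C g = Cod C f" "Dom C h = Cod C g"
  shows "h \<cdot> g \<cdot> f = h \<cdot> (g \<cdot> f)"
  using Comp_assoc[of f "Dom C f" "Cod C f" g "Cod C g" h "Cod C h"] assms
  by (auto simp: Hom_def)

text \<open>Composites are normalised to the right, which hides \<open>g \<cdot> f\<close> inside
  \<open>g \<cdot> (f \<cdot> x)\<close>; this rule applies a known equation there.\<close>

lemma Comp_rewrite:
  assumes "g \<cdot> f = h" "x \<in> Arr C" "f \<in> Arr C" "g \<in> Arr C" "Dom C f = Cod C x"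
    "Dom C g = Cod C f"
  shows "g \<cdot> (f \<cdot> x) = h \<cdot> x"
  using Comp_assoc'[of x f g] assms by simp

declare Dom_closed [simp] Cod_closed [simp]

lemma HomD [dest]:
  assumes "f \<in> Hom C A B"
  shows "f \<in> Arr C" "Dom C f = A" "Cod C f = B" "A \<in> Ob C" "B \<in> Ob C"
  using assms Dom_closed Cod_closed by (auto simp: Hom_def)

lemma HomI [intro]: "f \<in> Arr C \<Longrightarrow> Dom C f = A \<Longrightarrow> Cod C f = B \<Longrightarrow> f \<in> Hom C A B"
  by (simp add: Hom_def)

end

context preadditive_category
begin

abbreviation plus_arr (infixl "\<^bold>+" 65) where "f \<^bold>+ g \<equiv> Add C f g"

lemma Zero_arr [simp]:
  assumes "A \<in> Ob C" "B \<in> Ob C"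
  shows "Zero C A B \<in> Arr C" "Dom C (Zero C A B) = A" "Cod C (Zero C A B) = B"
proof -
  interpret G: comm_group "hom_group C A B" using assms by (rule hom_comm_group)
  show "Zero C A B \<in> Arr C" "Dom C (Zero C A B) = A" "Cod C (Zero C A B) = B"
    using G.one_closed by (auto simp: hom_group_def)
qed

lemma Add_arr [simp]:
  assumes "f \<in> Arr C" "g \<in> Arr C" "Dom C f = Dom C g" "Cod C f = Cod C g"
  shows "f \<^bold>+ g \<in> Arr C" "Dom C (f \<^bold>+ g) = Dom C g" "Cod C (f \<^bold>+ g) = Cod C g"
proof -
  interpret G: comm_group "hom_group C (Dom C g) (Cod C g)" using assms by (simp add: hom_comm_group)
  show "f \<^bold>+ g \<in> Arr C" "Dom C (f \<^bold>+ g) = Dom C g" "Cod C (f \<^bold>+ g) = Cod C g"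
    using G.m_closed[of f g] assms by (auto simp: hom_group_def Hom_def)
qed

lemma Add_Zero [simp]:
  assumes "f \<in> Arr C" "Dom C f = A" "Cod C f = B"
  shows "f \<^bold>+ Zero C A B = f" "Zero C A B \<^bold>+ f = f"
proof -
  interpret G: comm_group "hom_group C A B" using assms by (auto simp: hom_comm_group)
  show "f \<^bold>+ Zero C A B = f" "Zero C A B \<^bold>+ f = f"
    using G.r_one[of f] G.l_one[of f] assms by (auto simp: hom_group_def Hom_def)
qed

lemma Add_assoc:
  assumes "f \<in> Arr C" "g \<in> Arr C" "h \<in> Arr C" "Dom C f = Dom C h" "Cod C f = Cod C h"
    "Dom C g = Dom C h" "Cod C g = Cod C h"
  shows "f \<^bold>+ g \<^bold>+ h = f \<^bold>+ (g \<^bold>+ h)"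
proof -
  interpret G: comm_group "hom_group C (Dom C h) (Cod C h)" using assms by (simp add: hom_comm_group)
  show ?thesis using G.m_assoc[of f g h] assms by (auto simp: hom_group_def Hom_def)
qed

lemma Add_commute:
  assumes "f \<in> Arr C" "g \<in> Arr C" "Dom C f = Dom C g" "Cod C f = Cod C g"
  shows "f \<^bold>+ g = g \<^bold>+ f"
proof -
  interpret G: comm_group "hom_group C (Dom C g) (Cod C g)" using assms by (simp add: hom_comm_group)
  show ?thesis using G.m_comm[of f g] assms by (auto simp: hom_group_def Hom_def)
qed

lemma Add_cancel:
  assumes "f \<^bold>+ h = g \<^bold>+ h" "f \<in> Hom C A B" "g \<in> Hom C A B" "h \<in> Hom C A B"
  shows "f = g"
proof -
  interpret G: comm_group "hom_group C A B" using assms by (blast intro: hom_comm_group)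
  show ?thesis using G.right_cancel[of h f g] assms by (auto simp: hom_group_def)
qed

text \<open>The record has no operation for negatives. Below, a chosen \<open>n\<close> of this kind
  stands for \<open>- f\<close>, and differences are sums with such an \<open>n\<close>.\<close>

lemma ex_negative:
  assumes "f \<in> Hom C A B"
  obtains n where "n \<in> Hom C A B" "n \<^bold>+ f = Zero C A B"
proof -
  interpret G: comm_group "hom_group C A B" using assms by (blast intro: hom_comm_group)
  show ?thesis using G.l_inv_ex[of f] assms that by (auto simp: hom_group_def)
qed

lemma Add_Comp [simp]:
  assumes "f \<in> Arr C" "g \<in> Arr C" "h \<in> Arr C" "Dom C g = Cod C f" "Dom C h = Cod C f"
    "Cod C g = Cod C h"
  shows "(g \<^bold>+ h) \<cdot> f = g \<cdot> f \<^bold>+ h \<cdot> f"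
  using Comp_Add_left[of f "Dom C f" "Cod C f" g "Cod C g" h] assms by (simp add: Hom_def)

lemma Comp_Add [simp]:
  assumes "f \<in> Arr C" "g \<in> Arr C" "h \<in> Arr C" "Dom C h = Cod C f" "Dom C f = Dom C g"
    "Cod C f = Cod C g"
  shows "h \<cdot> (f \<^bold>+ g) = h \<cdot> f \<^bold>+ h \<cdot> g"
  using Comp_Add_right[of f "Dom C f" "Cod C f" g h "Cod C h"] assms by (simp add: Hom_def)

lemma Comp_Zero [simp]:
  assumes "f \<in> Arr C" "Dom C f = B" "A \<in> Ob C"
  shows "f \<cdot> Zero C A B = Zero C A (Cod C f)"
proof -
  have B: "B \<in> Ob C" using assms by auto
  let ?z = "f \<cdot> Zero C A B"
  have "f \<cdot> (Zero C A B \<^bold>+ Zero C A B) = ?z \<^bold>+ ?z" using assms B by (subst Comp_Add) auto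
  then have "?z \<^bold>+ ?z = Zero C A (Cod C f) \<^bold>+ ?z" using assms B by simp
  then show ?thesis by (rule Add_cancel[of _ _ _ A "Cod C f"]) (use assms B in auto)
qed

lemma Zero_Comp [simp]:
  assumes "f \<in> Arr C" "Cod C f = A" "B \<in> Ob C"
  shows "Zero C A B \<cdot> f = Zero C (Dom C f) B"
proof -
  have A: "A \<in> Ob C" using assms by auto
  let ?z = "Zero C A B \<cdot> f"
  have "(Zero C A B \<^bold>+ Zero C A B) \<cdot> f = ?z \<^bold>+ ?z" using assms A by (subst Add_Comp) auto
  then have "?z \<^bold>+ ?z = Zero C (Dom C f) B \<^bold>+ ?z" using assms A by simp
  then show ?thesis by (rule Add_cancel[of _ _ _ "Dom C f" B]) (use assms A in auto)
qed

text \<open>Every arrow into or out of \<open>Z\<close> factors through \<open>Id C Z\<close>, so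
  all of them vanish as soon as the identity does.\<close>

lemma zero_object_iff: "zero_object C Z \<longleftrightarrow> Z \<in> Ob C \<and> Id C Z = Zero C Z Z"
proof
  assume "zero_object C Z"
  then show "Z \<in> Ob C \<and> Id C Z = Zero C Z Z"
    unfolding zero_object_def by (metis HomI Id_arr Zero_arr)
next
  assume Z: "Z \<in> Ob C \<and> Id C Z = Zero C Z Z"
  have 1: "f = Zero C Z A" if "f \<in> Hom C Z A" for f A
    using Comp_Id_right[of f Z] Comp_Zero[of f Z Z] that Z by (auto simp: Hom_def)
  have 2: "f = Zero C A Z" if "f \<in> Hom C A Z" for f A
    using Comp_Id_left[of f Z] Zero_Comp[of f Z Z] that Z by (auto simp: Hom_def)
  show "zero_object C Z"
    unfolding zero_object_def using Z 1 2 by (metis HomI Zero_arr)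
qed

lemma from_zero_object: "zero_object C Z \<Longrightarrow> f \<in> Hom C Z A \<Longrightarrow> f = Zero C Z A"
  unfolding zero_object_def by (metis HomD(5) HomI Zero_arr)

lemma to_zero_object: "zero_object C Z \<Longrightarrow> f \<in> Hom C A Z \<Longrightarrow> f = Zero C A Z"
  unfolding zero_object_def by (metis HomD(4) HomI Zero_arr)

section \<open>Biproducts and direct sums\<close>

text \<open>The case of two summands of \<open>direct_sum\<close>, with the four structure maps as
  arguments instead of bound families, and without a finite product.\<close>

definition biproduct where
  "biproduct A B S i p j q \<longleftrightarrow> i \<in> Hom C A S \<and> p \<in> Hom C S A \<and> j \<in> Hom C B S \<and> q \<in> Hom C S B \<and>
     p \<cdot> i = Id C A \<and> q \<cdot> j = Id C B \<and> p \<cdot> j = Zero C B A \<and> q \<cdot> i = Zero C A B \<and>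
     i \<cdot> p \<^bold>+ j \<cdot> q = Id C S"

text \<open>The last four rules are the biproduct equations followed by a further arrow, in the form
  in which they occur in right-associated composites.\<close>

lemma biproductD:
  assumes "biproduct A B S i p j q"
  shows "i \<in> Arr C" "p \<in> Arr C" "j \<in> Arr C" "q \<in> Arr C"
    "Dom C i = A" "Cod C i = S" "Dom C p = S" "Cod C p = A"
    "Dom C j = B" "Cod C j = S" "Dom C q = S" "Cod C q = B"
    "A \<in> Ob C" "B \<in> Ob C" "S \<in> Ob C"
    "p \<cdot> i = Id C A" "q \<cdot> j = Id C B" "p \<cdot> j = Zero C B A" "q \<cdot> i = Zero C A B"
    "i \<cdot> p \<^bold>+ j \<cdot> q = Id C S"
    "\<And>x. x \<in> Arr C \<Longrightarrow> Cod C x = A \<Longrightarrow> p \<cdot> (i \<cdot> x) = x"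
    "\<And>x. x \<in> Arr C \<Longrightarrow> Cod C x = B \<Longrightarrow> q \<cdot> (j \<cdot> x) = x"
    "\<And>x. x \<in> Arr C \<Longrightarrow> Cod C x = B \<Longrightarrow> p \<cdot> (j \<cdot> x) = Zero C (Dom C x) A"
    "\<And>x. x \<in> Arr C \<Longrightarrow> Cod C x = A \<Longrightarrow> q \<cdot> (i \<cdot> x) = Zero C (Dom C x) B"
proof -
  have ob: "A \<in> Ob C" "B \<in> Ob C" "S \<in> Ob C" using assms by (auto simp: biproduct_def)
  show "i \<in> Arr C" "p \<in> Arr C" "j \<in> Arr C" "q \<in> Arr C"
    "Dom C i = A" "Cod C i = S" "Dom C p = S" "Cod C p = A"
    "Dom C j = B" "Cod C j = S" "Dom C q = S" "Cod C q = B"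
    "A \<in> Ob C" "B \<in> Ob C" "S \<in> Ob C"
    "p \<cdot> i = Id C A" "q \<cdot> j = Id C B" "p \<cdot> j = Zero C B A" "q \<cdot> i = Zero C A B"
    "i \<cdot> p \<^bold>+ j \<cdot> q = Id C S"
    "\<And>x. x \<in> Arr C \<Longrightarrow> Cod C x = A \<Longrightarrow> p \<cdot> (i \<cdot> x) = x"
    "\<And>x. x \<in> Arr C \<Longrightarrow> Cod C x = B \<Longrightarrow> q \<cdot> (j \<cdot> x) = x"
    "\<And>x. x \<in> Arr C \<Longrightarrow> Cod C x = B \<Longrightarrow> p \<cdot> (j \<cdot> x) = Zero C (Dom C x) A"
    "\<And>x. x \<in> Arr C \<Longrightarrow> Cod C x = A \<Longrightarrow> q \<cdot> (i \<cdot> x) = Zero C (Dom C x) B"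
    using assms ob by (auto simp: biproduct_def Hom_def Comp_rewrite)
qed

lemma biproduct_swap:
  assumes "biproduct A B S i p j q"
  shows "biproduct B A S j q i p"
proof -
  note b = biproductD[OF assms]
  have "j \<cdot> q \<^bold>+ i \<cdot> p = Id C S" using b by (subst Add_commute) auto
  with b show ?thesis by (auto simp: biproduct_def)
qed

lemma biproduct_decompose:
  assumes "biproduct A B S i p j q" "t \<in> Arr C" "Cod C t = S"
  shows "t = i \<cdot> (p \<cdot> t) \<^bold>+ j \<cdot> (q \<cdot> t)"
proof -
  note b = biproductD[OF assms(1)]
  have "t = (i \<cdot> p \<^bold>+ j \<cdot> q) \<cdot> t" using assms b by simp
  also have "\<dots> = i \<cdot> (p \<cdot> t) \<^bold>+ j \<cdot> (q \<cdot> t)"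
    using assms b(1-12) by simp
  finally show ?thesis .
qed

section \<open>Finite direct sums and iterated biproducts\<close>

lemma finprod_lessThan_0:
  assumes "A \<in> Ob C" "B \<in> Ob C"
  shows "finprod (hom_group C A B) F {..<0::nat} = Zero C A B"
proof -
  interpret G: comm_group "hom_group C A B" using assms by (rule hom_comm_group)
  show ?thesis by (simp add: G.finprod_empty) (simp add: hom_group_def)
qed

lemma finprod_lessThan_Suc:
  assumes "A \<in> Ob C" "B \<in> Ob C" "\<And>k. k < Suc n \<Longrightarrow> F k \<in> Hom C A B"
  shows "finprod (hom_group C A B) F {..<Suc n} =
    F 0 \<^bold>+ finprod (hom_group C A B) (\<lambda>k. F (Suc k)) {..<n}"
proof -
  interpret G: comm_group "hom_group C A B" using assms by (auto simp: hom_comm_group)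
  have F: "F \<in> {..<Suc n} \<rightarrow> carrier (hom_group C A B)" using assms by (auto simp: hom_group_def)
  have "finprod (hom_group C A B) F (insert 0 (Suc ` {..<n})) =
    F 0 \<otimes>\<^bsub>hom_group C A B\<^esub> finprod (hom_group C A B) F (Suc ` {..<n})"
    using F by (intro G.finprod_insert) auto
  also have "finprod (hom_group C A B) F (Suc ` {..<n}) =
    finprod (hom_group C A B) (\<lambda>k. F (Suc k)) {..<n}"
    using F by (intro G.finprod_reindex) auto
  finally show ?thesis by (simp add: lessThan_Suc_eq_insert_0 hom_group_def)
qed

lemma finprod_Hom:
  assumes "A \<in> Ob C" "B \<in> Ob C" "\<And>k. k < n \<Longrightarrow> F k \<in> Hom C A B"
  shows "finprod (hom_group C A B) F {..<n::nat} \<in> Hom C A B"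
proof -
  interpret G: comm_group "hom_group C A B" using assms by (auto simp: hom_comm_group)
  show ?thesis using G.finprod_closed[of F "{..<n}"] assms by (auto simp: hom_group_def)
qed

text \<open>Needed to carry the decomposition of an identity through the maps of a biproduct, both
  when a family is lengthened and when it is shortened by one term.\<close>

lemma Comp_finprod_Comp:
  assumes "f \<in> Hom C A B" "g \<in> Hom C D E" "\<And>k. k < n \<Longrightarrow> F k \<in> Hom C B D"
  shows "g \<cdot> (finprod (hom_group C B D) F {..<n::nat} \<cdot> f) =
    finprod (hom_group C A E) (\<lambda>k. g \<cdot> (F k \<cdot> f)) {..<n}"
  using assms(3)
proof (induction n arbitrary: F)
  case 0
  have "A \<in> Ob C" "B \<in> Ob C" "D \<in> Ob C" "E \<in> Ob C" using assms by auto
  then show ?case using assms by (auto simp: finprod_lessThan_0[simplified] Hom_def)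
next
  case (Suc n)
  have ob: "A \<in> Ob C" "B \<in> Ob C" "D \<in> Ob C" "E \<in> Ob C" using assms by auto
  let ?P = "finprod (hom_group C B D) (\<lambda>k. F (Suc k)) {..<n}"
  have P: "?P \<in> Hom C B D" using finprod_Hom[of B D n "\<lambda>k. F (Suc k)"] ob Suc.prems by auto
  have F0: "F 0 \<in> Hom C B D" using Suc.prems by auto
  have "g \<cdot> ((F 0 \<^bold>+ ?P) \<cdot> f) = g \<cdot> (F 0 \<cdot> f) \<^bold>+ g \<cdot> (?P \<cdot> f)"
    using P F0 assms by (simp add: Hom_def)
  moreover have "g \<cdot> (?P \<cdot> f) = finprod (hom_group C A E) (\<lambda>k. g \<cdot> (F (Suc k) \<cdot> f)) {..<n}"
    using Suc by auto
  moreover have "\<And>k. k < Suc n \<Longrightarrow> g \<cdot> (F k \<cdot> f) \<in> Hom C A E"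
    using Suc.prems assms by (force simp: Hom_def)
  ultimately show ?case using Suc.prems ob by (simp add: finprod_lessThan_Suc)
qed

lemma direct_sum_Nil: "direct_sum C [] S \<longleftrightarrow> zero_object C S"
  by (auto simp: direct_sum_def zero_object_iff finprod_lessThan_0[simplified])

lemma direct_sum_pair: "direct_sum C [A, B] S \<longleftrightarrow> (\<exists>i p j q. biproduct A B S i p j q)"
proof
  assume "direct_sum C [A, B] S"
  then obtain \<iota> \<pi> where ob: "A \<in> Ob C" "B \<in> Ob C" "S \<in> Ob C"
    and hom: "\<forall>k < Suc (Suc 0). \<iota> k \<in> Hom C ([A, B] ! k) S \<and> \<pi> k \<in> Hom C S ([A, B] ! k)"
    and eq: "\<forall>j < Suc (Suc 0). \<forall>k < Suc (Suc 0). \<pi> j \<cdot> \<iota> k = (if j = k then Id C ([A, B] ! k) else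
        Zero C ([A, B] ! k) ([A, B] ! j))"
    and s: "finprod (hom_group C S S) (\<lambda>k. \<iota> k \<cdot> \<pi> k) {..<Suc (Suc 0)} = Id C S"
    unfolding direct_sum_def by auto
  have h: "\<iota> 0 \<in> Hom C A S" "\<pi> 0 \<in> Hom C S A" "\<iota> 1 \<in> Hom C B S" "\<pi> 1 \<in> Hom C S B"
    using hom by auto
  have "\<iota> k \<cdot> \<pi> k \<in> Hom C S S" if "k < Suc (Suc 0)" for k
    using hom that by (auto simp: Hom_def)
  then have "\<iota> 0 \<cdot> \<pi> 0 \<^bold>+ \<iota> 1 \<cdot> \<pi> 1 = Id C S"
    using s ob h by (simp add: finprod_lessThan_Suc finprod_lessThan_0[simplified] Hom_def)
  then have "biproduct A B S (\<iota> 0) (\<pi> 0) (\<iota> 1) (\<pi> 1)"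
    using h eq by (simp add: biproduct_def)
  then show "\<exists>i p j q. biproduct A B S i p j q" by blast
next
  assume "\<exists>i p j q. biproduct A B S i p j q"
  then obtain i p j q where b: "biproduct A B S i p j q" by blast
  then have ob: "A \<in> Ob C" "B \<in> Ob C" "S \<in> Ob C" by (auto simp: biproduct_def)
  let ?i = "\<lambda>k::nat. if k = 0 then i else j"
  let ?p = "\<lambda>k::nat. if k = 0 then p else q"
  have "i \<cdot> p \<in> Hom C S S" "j \<cdot> q \<in> Hom C S S" using b by (auto simp: biproduct_def Hom_def)
  then have "finprod (hom_group C S S) (\<lambda>k. ?i k \<cdot> ?p k) {..<Suc (Suc 0)} = Id C S"
    using b ob
    by (simp add: finprod_lessThan_Suc finprod_lessThan_0[simplified])
       (auto simp add: Hom_def biproduct_def)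
  then show "direct_sum C [A, B] S"
    using b ob unfolding direct_sum_def
    by (simp add: less_Suc_eq)
       (rule exI[of _ ?i], rule exI[of _ ?p], auto simp: biproduct_def)
qed

lemma direct_sum_ConsI:
  assumes "direct_sum C As T" "direct_sum C [A, T] S"
  shows "direct_sum C (A # As) S"
proof -
  obtain i p j q where b: "biproduct A T S i p j q" using assms direct_sum_pair by blast
  note bE = biproductD[OF b]
  obtain \<iota> \<pi> where ob: "set As \<subseteq> Ob C"
    and hom': "\<forall>k < length As. \<iota> k \<in> Hom C (As ! k) T \<and> \<pi> k \<in> Hom C T (As ! k)"
    and eq: "\<forall>l < length As. \<forall>k < length As. \<pi> l \<cdot> \<iota> k = (if l = k then Id C (As ! k) else
        Zero C (As ! k) (As ! l))"
    and s: "finprod (hom_group C T T) (\<lambda>k. \<iota> k \<cdot> \<pi> k) {..<length As} = Id C T"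
    using assms(1) unfolding direct_sum_def by blast
  have hom: "\<iota> k \<in> Hom C (As ! k) T \<and> \<pi> k \<in> Hom C T (As ! k)" if "k < length As" for k
    using hom' that by blast
  \<comment> \<open>Index 0 belongs to \<open>A\<close>; the indices of \<open>As\<close> move up by
    one and their maps pass through \<open>T\<close>.\<close>
  let ?i = "\<lambda>k. case k of 0 \<Rightarrow> i | Suc k \<Rightarrow> j \<cdot> \<iota> k"
  let ?p = "\<lambda>k. case k of 0 \<Rightarrow> p | Suc k \<Rightarrow> \<pi> k \<cdot> q"
  have ip: "\<iota> k \<cdot> \<pi> k \<in> Hom C T T" if "k < length As" for k
    using hom[OF that] by (auto simp: Hom_def)
  have a: "?i k \<in> Hom C ((A # As) ! k) S \<and> ?p k \<in> Hom C S ((A # As) ! k)"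
    if "k < length (A # As)" for k
    using bE that hom by (cases k) (auto simp: Hom_def)
  have b': "?p l \<cdot> ?i k = (if l = k then Id C ((A # As) ! k) else Zero C ((A # As) ! k) ((A # As) ! l))"
    if "l < length (A # As)" "k < length (A # As)" for l k
  proof -
    note h = hom[of "l - 1"] hom[of "k - 1"]
    show ?thesis using bE that h eq
      by (cases k; cases l) (auto simp: Hom_def)
  qed
  have S: "S \<in> Ob C" using b by (auto simp: biproduct_def)
  have "?i k \<cdot> ?p k \<in> Hom C S S" if "k < Suc (length As)" for k
    using a[of k] that by (simp add: Hom_def)
  then have "finprod (hom_group C S S) (\<lambda>k. ?i k \<cdot> ?p k) {..<Suc (length As)} =
    i \<cdot> p \<^bold>+ finprod (hom_group C S S) (\<lambda>k. (j \<cdot> \<iota> k) \<cdot> (\<pi> k \<cdot> q)) {..<length As}"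
    using S by (subst finprod_lessThan_Suc) auto
  \<comment> \<open>Reassociation requires composable maps, which are available only for indices
    below \<open>length As\<close>; hence the congruence rule.\<close>
  also have "finprod (hom_group C S S) (\<lambda>k. (j \<cdot> \<iota> k) \<cdot> (\<pi> k \<cdot> q)) {..<length As} =
    finprod (hom_group C S S) (\<lambda>k. j \<cdot> ((\<iota> k \<cdot> \<pi> k) \<cdot> q)) {..<length As}"
  proof -
    interpret G: comm_group "hom_group C S S" using S by (auto simp: hom_comm_group)
    show ?thesis
      using bE hom by (intro G.finprod_cong') (auto simp: hom_group_def Hom_def)
  qed
  also have "\<dots> = j \<cdot> (Id C T \<cdot> q)"
    using Comp_finprod_Comp[of q S T j T S "length As" "\<lambda>k. \<iota> k \<cdot> \<pi> k"] b ip s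
    by (auto simp: biproduct_def)
  also have "i \<cdot> p \<^bold>+ j \<cdot> (Id C T \<cdot> q) = Id C S"
    using b by (auto simp: biproduct_def Hom_def)
  finally have c: "finprod (hom_group C S S) (\<lambda>k. ?i k \<cdot> ?p k) {..<length (A # As)} = Id C S" by simp
  have "set (A # As) \<subseteq> Ob C" using ob b by (auto simp: biproduct_def)
  with S a b' c show ?thesis unfolding direct_sum_def by blast
qed

text \<open>A form of direct summand that mentions no complement, so that it composes at once. In an
  abelian category it agrees with \<open>direct_summand\<close>, see
  \<open>direct_summand_iff_retract\<close>.\<close>

definition retract where
  "retract Z Y \<longleftrightarrow> (\<exists>i \<in> Hom C Z Y. \<exists>p \<in> Hom C Y Z. p \<cdot> i = Id C Z)"

lemma retract_trans:
  assumes "retract X Y" "retract Y Z"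
  shows "retract X Z"
proof -
  obtain i p where 1: "i \<in> Hom C X Y" "p \<in> Hom C Y X" "p \<cdot> i = Id C X"
    using assms(1) by (auto simp: retract_def)
  obtain j q where 2: "j \<in> Hom C Y Z" "q \<in> Hom C Z Y" "q \<cdot> j = Id C Y"
    using assms(2) by (auto simp: retract_def)
  have "p \<cdot> q \<cdot> (j \<cdot> i) = p \<cdot> (q \<cdot> (j \<cdot> i))" using 1 2 by (auto simp: Hom_def)
  also have "q \<cdot> (j \<cdot> i) = Id C Y \<cdot> i"
    using 1 2 by (intro Comp_rewrite) (auto simp: Hom_def)
  also have "p \<cdot> (Id C Y \<cdot> i) = Id C X" using 1 by (auto simp: Hom_def)
  finally show ?thesis
    unfolding retract_def
    by (intro bexI[of _ "j \<cdot> i"] bexI[of _ "p \<cdot> q"]) (use 1 2 in \<open>simp_all add: Hom_def\<close>)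
qed

lemma retract_refl: "X \<in> Ob C \<Longrightarrow> retract X X"
  unfolding retract_def
  by (intro bexI[of _ "Id C X"]) auto

lemma retract_Ob: "retract X Y \<Longrightarrow> X \<in> Ob C \<and> Y \<in> Ob C"
  by (auto simp: retract_def)

lemma retract_zero_object: "retract Z Y \<Longrightarrow> zero_object C Y \<Longrightarrow> zero_object C Z"
proof -
  assume "retract Z Y" and Y: "zero_object C Y"
  then obtain i p where 1: "i \<in> Hom C Z Y" "p \<in> Hom C Y Z" "p \<cdot> i = Id C Z"
    by (auto simp: retract_def)
  have "p = Zero C Y Z" using Y 1 from_zero_object by blast
  with 1 have "Id C Z = Zero C Y Z \<cdot> i" by simp
  also have "\<dots> = Zero C Z Z" using 1(1) by (subst Zero_Comp) auto
  finally show "zero_object C Z" using 1 by (auto simp: zero_object_iff)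
qed

lemma biproduct_retract:
  assumes "biproduct A B S i p j q"
  shows "retract A S" "retract B S"
  using assms by (auto simp: biproduct_def retract_def)

lemma isomorphic_retract: "isomorphic C A B \<Longrightarrow> retract A B \<and> retract B A"
  by (auto simp: isomorphic_def retract_def)

lemma isomorphic_refl: "A \<in> Ob C \<Longrightarrow> isomorphic C A A"
  unfolding isomorphic_def by (metis Comp_Id_left Id_arr Id_closed)

lemma isomorphic_sym: "isomorphic C A B \<Longrightarrow> isomorphic C B A"
  unfolding isomorphic_def by blast

lemma isomorphic_trans:
  assumes "isomorphic C X Y" "isomorphic C Y Z"
  shows "isomorphic C X Z"
proof -
  obtain i p where 1: "i \<in> Hom C X Y" "p \<in> Hom C Y X" "p \<cdot> i = Id C X" "i \<cdot> p = Id C Y"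
    using assms(1) by (auto simp: isomorphic_def)
  obtain j q where 2: "j \<in> Hom C Y Z" "q \<in> Hom C Z Y" "q \<cdot> j = Id C Y" "j \<cdot> q = Id C Z"
    using assms(2) by (auto simp: isomorphic_def)
  have "p \<cdot> q \<cdot> (j \<cdot> i) = p \<cdot> (q \<cdot> (j \<cdot> i))" using 1 2 by (auto simp: Hom_def)
  also have "q \<cdot> (j \<cdot> i) = Id C Y \<cdot> i"
    using 1 2 by (intro Comp_rewrite) (auto simp: Hom_def)
  also have "p \<cdot> (Id C Y \<cdot> i) = Id C X" using 1 by (auto simp: Hom_def)
  finally have a: "p \<cdot> q \<cdot> (j \<cdot> i) = Id C X" .
  have "j \<cdot> i \<cdot> (p \<cdot> q) = j \<cdot> (i \<cdot> (p \<cdot> q))" using 1 2 by (auto simp: Hom_def)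
  also have "i \<cdot> (p \<cdot> q) = Id C Y \<cdot> q"
    using 1 2 by (intro Comp_rewrite) (auto simp: Hom_def)
  also have "j \<cdot> (Id C Y \<cdot> q) = Id C Z" using 2 by (auto simp: Hom_def)
  finally have "j \<cdot> i \<cdot> (p \<cdot> q) = Id C Z" .
  with a show ?thesis
    using 1 2 unfolding isomorphic_def
    by (intro conjI bexI[of _ "j \<cdot> i"] bexI[of _ "p \<cdot> q"]) (auto simp: Hom_def)
qed

lemma iso_class_eq_iff:
  assumes "A \<in> Ob C" "B \<in> Ob C"
  shows "iso_class C A = iso_class C B \<longleftrightarrow> isomorphic C A B"
proof
  assume "iso_class C A = iso_class C B"
  then have "B \<in> iso_class C A" using assms isomorphic_refl by (simp add: iso_class_def)
  then show "isomorphic C A B" by (simp add: iso_class_def)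
next
  assume "isomorphic C A B"
  then show "iso_class C A = iso_class C B"
    unfolding iso_class_def using isomorphic_trans isomorphic_sym by blast
qed

text \<open>A lift of \<open>f \<cdot> p\<close> from \<open>P\<close>, restricted along
  \<open>i\<close>, lifts \<open>f\<close> because \<open>p \<cdot> i\<close> is the
  identity.\<close>

lemma projective_retract:
  assumes "retract Z P" "projective C P"
  shows "projective C Z"
  unfolding projective_def
proof (intro conjI allI impI)
  obtain i p where 1: "i \<in> Hom C Z P" "p \<in> Hom C P Z" "p \<cdot> i = Id C Z"
    using assms by (auto simp: retract_def)
  show "Z \<in> Ob C" using 1 by auto
  fix g f
  assume gf: "epic C g \<and> f \<in> Hom C Z (Cod C g)"
  then have "f \<cdot> p \<in> Hom C P (Cod C g)" using 1 by (auto simp: Hom_def)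
  then obtain h where h: "h \<in> Hom C P (Dom C g)" "g \<cdot> h = f \<cdot> p"
    using assms gf unfolding projective_def by blast
  have "g \<cdot> (h \<cdot> i) = f \<cdot> p \<cdot> i"
    using gf h 1 by (intro Comp_rewrite) (auto simp: epic_def Hom_def)
  also have "\<dots> = f" using 1 gf by (auto simp: Hom_def)
  finally show "\<exists>h \<in> Hom C Z (Dom C g). g \<cdot> h = f"
    using h 1 by (intro bexI[of _ "h \<cdot> i"]) (auto simp: Hom_def)
qed

lemma retract_cancel:
  assumes "i \<in> Arr C" "p \<in> Arr C" "Cod C i = Dom C p" "p \<cdot> i = Id C Z" "x \<in> Arr C" "Cod C x = Dom C i"
    "Dom C i = Z"
  shows "p \<cdot> (i \<cdot> x) = x"
  using Comp_rewrite[of p i "Id C Z" x] assms by auto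

section \<open>Kernels, cokernels and generalised elements\<close>

lemma kernelD:
  assumes "is_kernel C k f"
  shows "k \<in> Arr C" "f \<in> Arr C" "Cod C k = Dom C f" "f \<cdot> k = Zero C (Dom C k) (Cod C f)"
  using assms by (auto simp: is_kernel_def)

lemma kernel_factor:
  assumes "is_kernel C k f" "t \<in> Arr C" "Cod C t = Dom C f" "f \<cdot> t = Zero C (Dom C t) (Cod C f)"
  obtains h where "h \<in> Hom C (Dom C t) (Dom C k)" "k \<cdot> h = t"
  using assms unfolding is_kernel_def by (metis Dom_closed HomI)

text \<open>Both \<open>x\<close> and \<open>y\<close> factor the same arrow
  \<open>k \<cdot> y\<close>, which \<open>f\<close> kills; the universal property allows only one
  factorisation.\<close>

lemma kernel_cancel:
  assumes "is_kernel C k f" "k \<cdot> x = k \<cdot> y" "x \<in> Arr C" "y \<in> Arr C" "Cod C x = Dom C k"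
    "Cod C y = Dom C k" "Dom C x = Dom C y"
  shows "x = y"
proof -
  note k = kernelD[OF assms(1)]
  have "f \<cdot> (k \<cdot> y) = Zero C (Dom C y) (Cod C f)"
    using Comp_rewrite[OF k(4), of y] k assms by simp
  moreover have "k \<cdot> y \<in> Hom C (Dom C y) (Dom C f)" using k assms by auto
  ultimately have "\<exists>!h. h \<in> Hom C (Dom C y) (Dom C k) \<and> k \<cdot> h = k \<cdot> y"
    using assms(1,4) unfolding is_kernel_def by simp
  then show ?thesis using assms by (metis HomI)
qed

lemma cokernelD:
  assumes "is_cokernel C c f"
  shows "c \<in> Arr C" "f \<in> Arr C" "Dom C c = Cod C f" "c \<cdot> f = Zero C (Dom C f) (Cod C c)"
  using assms by (auto simp: is_cokernel_def)

lemma cokernel_factor: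
  assumes "is_cokernel C c f" "t \<in> Arr C" "Dom C t = Cod C f" "t \<cdot> f = Zero C (Dom C f) (Cod C t)"
  obtains h where "h \<in> Hom C (Cod C c) (Cod C t)" "h \<cdot> c = t"
  using assms unfolding is_cokernel_def by (metis Cod_closed HomI)

lemma kernel_monic:
  assumes "is_kernel C k f"
  shows "monic C k"
  unfolding monic_def using kernelD[OF assms] kernel_cancel[OF assms] by (auto simp: Hom_def)

lemma cokernel_cancel:
  assumes "is_cokernel C c f" "x \<cdot> c = y \<cdot> c" "x \<in> Arr C" "y \<in> Arr C" "Dom C x = Cod C c"
    "Dom C y = Cod C c" "Cod C x = Cod C y"
  shows "x = y"
proof -
  note c = cokernelD[OF assms(1)]
  have "y \<cdot> (c \<cdot> f) = Zero C (Dom C f) (Cod C y)" using c assms by simp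
  then have "y \<cdot> c \<cdot> f = Zero C (Dom C f) (Cod C y)" using c assms by simp
  moreover have "y \<cdot> c \<in> Hom C (Cod C f) (Cod C y)" using c assms by auto
  ultimately have "\<exists>!h. h \<in> Hom C (Cod C c) (Cod C y) \<and> h \<cdot> c = y \<cdot> c"
    using assms(1,4) unfolding is_cokernel_def by simp
  then show ?thesis using assms by (metis HomI)
qed

lemma cokernel_epic:
  assumes "is_cokernel C c f"
  shows "epic C c"
  unfolding epic_def
proof (intro conjI ballI impI)
  fix T g h
  assume "g \<in> Hom C (Cod C c) T" "h \<in> Hom C (Cod C c) T" "g \<cdot> c = h \<cdot> c"
  then show "g = h" by (intro cokernel_cancel[OF assms, of g h]) auto
qed (rule cokernelD(1)[OF assms])

lemma monic_cancel_zero: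
  assumes "monic C f" "t \<in> Arr C" "Cod C t = Dom C f" "f \<cdot> t = Zero C (Dom C t) (Cod C f)"
  shows "t = Zero C (Dom C t) (Dom C f)"
proof -
  have "f \<in> Arr C" using assms by (auto simp: monic_def)
  then have "f \<cdot> t = f \<cdot> Zero C (Dom C t) (Dom C f)" using assms by simp
  then show ?thesis using assms \<open>f \<in> Arr C\<close> unfolding monic_def
    by (metis Dom_closed HomI Zero_arr)
qed

text \<open>Additivity reduces cancellation to the vanishing of a difference: in the proof
  \<open>n\<close> is the negative of \<open>g\<close>, so \<open>n + h\<close> is
  \<open>h - g\<close>.\<close>

lemma monicI:
  assumes "f \<in> Arr C" "\<And>t. t \<in> Arr C \<Longrightarrow> Cod C t = Dom C f \<Longrightarrow> f \<cdot> t = Zero C (Dom C t) (Cod C f)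
    \<Longrightarrow> t = Zero C (Dom C t) (Dom C f)"
  shows "monic C f"
  unfolding monic_def
proof (intro conjI ballI impI)
  fix T g h
  assume T: "T \<in> Ob C" and g: "g \<in> Hom C T (Dom C f)" and h: "h \<in> Hom C T (Dom C f)"
    and eq: "f \<cdot> g = f \<cdot> h"
  obtain n where n: "n \<in> Hom C T (Dom C f)" "n \<^bold>+ g = Zero C T (Dom C f)"
    using ex_negative[OF g] .
  have "f \<cdot> (n \<^bold>+ h) = f \<cdot> (n \<^bold>+ g)" using g h n(1) eq assms(1) by (simp add: Hom_def)
  also have "\<dots> = Zero C T (Cod C f)" using n T assms(1) by simp
  finally have "n \<^bold>+ h = Zero C T (Dom C f)"
    using assms(2)[of "n \<^bold>+ h"] n g h by (simp add: Hom_def)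
  with n have "g \<^bold>+ n = h \<^bold>+ n" using g h by (metis Add_commute HomD(1-3))
  then show "g = h" by (rule Add_cancel) (use g h n in auto)
qed (use assms in auto)

lemma epicI:
  assumes "f \<in> Arr C" "\<And>t. t \<in> Arr C \<Longrightarrow> Dom C t = Cod C f \<Longrightarrow> t \<cdot> f = Zero C (Dom C f) (Cod C t)
    \<Longrightarrow> t = Zero C (Cod C f) (Cod C t)"
  shows "epic C f"
  unfolding epic_def
proof (intro conjI ballI impI)
  fix T g h
  assume T: "T \<in> Ob C" and g: "g \<in> Hom C (Cod C f) T" and h: "h \<in> Hom C (Cod C f) T"
    and eq: "g \<cdot> f = h \<cdot> f"
  obtain n where n: "n \<in> Hom C (Cod C f) T" "n \<^bold>+ g = Zero C (Cod C f) T"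
    using ex_negative[OF g] .
  have "(n \<^bold>+ h) \<cdot> f = (n \<^bold>+ g) \<cdot> f" using g h n(1) eq assms(1) by (simp add: Hom_def)
  also have "\<dots> = Zero C (Dom C f) T" using n T assms(1) by simp
  finally have "n \<^bold>+ h = Zero C (Cod C f) T"
    using assms(2)[of "n \<^bold>+ h"] n g h by (simp add: Hom_def)
  with n have "g \<^bold>+ n = h \<^bold>+ n" using g h by (metis Add_commute HomD(1-3))
  then show "g = h" by (rule Add_cancel) (use g h n in auto)
qed (use assms in auto)

lemma epic_cancel:
  assumes "epic C f" "x \<cdot> f = y \<cdot> f" "x \<in> Arr C" "y \<in> Arr C" "Dom C x = Cod C f"
    "Dom C y = Cod C f" "Cod C x = Cod C y"
  shows "x = y"
  using assms unfolding epic_def by (metis Cod_closed HomI)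

lemma epic_comp:
  assumes "epic C f" "epic C g" "Cod C f = Dom C g"
  shows "epic C (g \<cdot> f)"
proof -
  have fg: "f \<in> Arr C" "g \<in> Arr C" using assms by (auto simp: epic_def)
  show ?thesis unfolding epic_def
  proof (intro conjI ballI impI)
    fix T x y
    assume x: "x \<in> Hom C (Cod C (g \<cdot> f)) T" and y: "y \<in> Hom C (Cod C (g \<cdot> f)) T"
      and eq: "x \<cdot> (g \<cdot> f) = y \<cdot> (g \<cdot> f)"
    have "(x \<cdot> g) \<cdot> f = (y \<cdot> g) \<cdot> f" using eq x y fg assms by (auto simp: Hom_def)
    then have "x \<cdot> g = y \<cdot> g"
      by (rule epic_cancel[OF assms(1)]) (use x y fg assms in \<open>simp_all add: Hom_def\<close>)
    then show "x = y"
      by (rule epic_cancel[OF assms(2)]) (use x y fg assms in \<open>simp_all add: Hom_def\<close>)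
  qed (use fg assms in auto)
qed

text \<open>Used below in the form: an arrow is epic as soon as its restriction along some other
  arrow is.\<close>

lemma epic_of_comp:
  assumes "epic C (g \<cdot> f)" "f \<in> Arr C" "g \<in> Arr C" "Cod C f = Dom C g"
  shows "epic C g"
proof (rule epicI)
  fix t assume t: "t \<in> Arr C" "Dom C t = Cod C g" "t \<cdot> g = Zero C (Dom C g) (Cod C t)"
  have "t \<cdot> (g \<cdot> f) = Zero C (Dom C g) (Cod C t) \<cdot> f"
    using t assms by (intro Comp_rewrite) auto
  also have "\<dots> = Zero C (Cod C g) (Cod C t) \<cdot> (g \<cdot> f)" using t assms by simp
  finally show "t = Zero C (Cod C g) (Cod C t)"
    by (rule epic_cancel[OF assms(1)]) (use t assms in auto)
qed (use assms in auto)

lemma epic_Id: "A \<in> Ob C \<Longrightarrow> epic C (Id C A)"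
  by (auto simp: epic_def Hom_def)

end

section \<open>Consequences of the abelian axioms: complements, pullbacks of epimorphisms,
  exactness\<close>

context abelian_category
begin

text \<open>The complement is the kernel of \<open>p\<close>. The idempotent
  \<open>Id - i \<cdot> p\<close> is killed by \<open>p\<close> and hence factors through this
  kernel, which gives the second projection.\<close>

lemma retract_biproduct:
  assumes i: "i \<in> Hom C Z Y" and p: "p \<in> Hom C Y Z" and pi: "p \<cdot> i = Id C Z"
  shows "\<exists>W w q. biproduct Z W Y i p w q"
proof -
  have ob: "Z \<in> Ob C" "Y \<in> Ob C" using i by auto
  have ip': "i \<cdot> p \<in> Hom C Y Y" using i p by (auto simp: Hom_def)
  \<comment> \<open>\<open>n\<close> is the negative of \<open>i \<cdot> p\<close>, so
    \<open>?e\<close> below is the complementary idempotent.\<close>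
  then obtain n where n: "n \<in> Hom C Y Y" "n \<^bold>+ i \<cdot> p = Zero C Y Y" using ex_negative by blast
  obtain w where w: "is_kernel C w p" using ex_kernel p by blast
  note wD = kernelD[OF w]
  let ?W = "Dom C w"
  let ?e = "n \<^bold>+ Id C Y"
  have e: "?e \<in> Arr C" "Dom C ?e = Y" "Cod C ?e = Y" using n i p ob by (auto simp: Hom_def)
  have "p \<cdot> (i \<cdot> p) = p" using retract_cancel[of i p Z p] i p pi by (simp add: Hom_def)
  then have "p \<cdot> ?e = p \<cdot> (n \<^bold>+ i \<cdot> p)" using n(1) i p ob by (simp add: Hom_def)
  also have "\<dots> = Zero C Y Z" using n(2) p by (auto simp: Hom_def)
  finally have "p \<cdot> ?e = Zero C Y Z" .
  then obtain q where q: "q \<in> Hom C Y ?W" "w \<cdot> q = ?e"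
    using kernel_factor[OF w e(1)] e p by (auto simp: Hom_def)
  have sum: "i \<cdot> p \<^bold>+ w \<cdot> q = Id C Y"
  proof -
    have "i \<cdot> p \<^bold>+ w \<cdot> q = (n \<^bold>+ i \<cdot> p) \<^bold>+ Id C Y"
      unfolding q using n(1) ip' ob by (subst Add_assoc[symmetric]) (auto simp: Hom_def Add_commute)
    then show ?thesis using n ob by simp
  qed
  \<comment> \<open>Equations for \<open>q\<close> are checked after composition with the monic
    \<open>w\<close>, since \<open>w \<cdot> q\<close> is known to be \<open>?e\<close>.\<close>
  have "w \<cdot> (q \<cdot> i) = ?e \<cdot> i" using q w wD i p by (intro Comp_rewrite) (auto simp: Hom_def)
  also have "\<dots> = n \<cdot> i \<^bold>+ (i \<cdot> p) \<cdot> i" using n(1) i p pi ob by (simp add: Hom_def)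
  also have "\<dots> = (n \<^bold>+ i \<cdot> p) \<cdot> i" using n(1) i p ob by (simp add: Hom_def)
  also have "\<dots> = w \<cdot> Zero C Z ?W" using n(2) i p wD ob by (simp add: Hom_def)
  finally have qi: "q \<cdot> i = Zero C Z ?W"
    by (rule kernel_cancel[OF w]) (use q i p wD ob in \<open>simp_all add: Hom_def\<close>)
  have pw: "p \<cdot> w = Zero C ?W Z" using wD p by (simp add: Hom_def)
  have "w \<cdot> (q \<cdot> w) = ?e \<cdot> w" using q w wD i p by (intro Comp_rewrite) (auto simp: Hom_def)
  also have "\<dots> = n \<cdot> w \<^bold>+ w" using n(1) i p wD ob by (simp add: Hom_def)
  also have "n \<cdot> w = n \<cdot> w \<^bold>+ (i \<cdot> p) \<cdot> w" using n(1) i p wD ob by (simp add: Hom_def)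
  also have "\<dots> = (n \<^bold>+ i \<cdot> p) \<cdot> w" using n(1) i p wD ob by (simp add: Hom_def)
  also have "\<dots> = Zero C ?W Y" using n(2) wD p ob by (simp add: Hom_def)
  also have "\<dots> \<^bold>+ w = w \<cdot> Id C ?W" using wD p by (simp add: Hom_def)
  finally have qw: "q \<cdot> w = Id C ?W"
    by (rule kernel_cancel[OF w]) (use q i p wD ob in \<open>simp_all add: Hom_def\<close>)
  have "biproduct Z ?W Y i p w q"
    using i p q pi qi qw pw sum wD by (auto simp: biproduct_def Hom_def)
  then show ?thesis by blast
qed

lemma direct_summand_iff_retract: "direct_summand C Z Y \<longleftrightarrow> retract Z Y"
  using retract_biproduct biproduct_retract
  unfolding direct_summand_def direct_sum_pair retract_def by metis

text \<open>The fibre product is the kernel \<open>k\<close> of the difference map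
  \<open>?h\<close>, and \<open>q \<cdot> k\<close> is its projection to the domain of
  \<open>t\<close>. The map \<open>?h\<close> is epic because it restricts to \<open>f\<close>, so
  it is the cokernel of some \<open>g\<close>, which factors through \<open>k\<close>. If
  \<open>u\<close> kills \<open>q \<cdot> k\<close>, then \<open>u \<cdot> q\<close> kills
  \<open>g\<close> and equals \<open>w \<cdot> ?h\<close>. Restriction to the first summand gives
  \<open>w \<cdot> f\<close> = 0, hence \<open>w\<close> = 0 and \<open>u\<close> = 0.\<close>

lemma epic_pullback:
  assumes f: "epic C f" and t: "t \<in> Arr C" "Cod C t = Cod C f"
  obtains e x where "epic C e" "e \<in> Arr C" "Cod C e = Dom C t" "x \<in> Hom C (Dom C e) (Dom C f)"
    "t \<cdot> e = f \<cdot> x"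
proof -
  have fa: "f \<in> Arr C" using f by (simp add: epic_def)
  obtain S i p j q where S: "biproduct (Dom C f) (Dom C t) S i p j q"
    using ex_direct_sum[of "Dom C f" "Dom C t"] fa t by (auto simp: direct_sum_pair)
  note S' = biproductD[OF S]
  obtain n where n: "n \<in> Hom C (Dom C t) (Cod C t)" "n \<^bold>+ t = Zero C (Dom C t) (Cod C t)"
    using ex_negative[of t "Dom C t" "Cod C t"] t by blast
  \<comment> \<open>Since \<open>n\<close> is the negative of \<open>t\<close>, this is the
    difference of the two maps into their common codomain.\<close>
  let ?h = "f \<cdot> p \<^bold>+ n \<cdot> q"
  have h: "?h \<in> Arr C" "Dom C ?h = S" "Cod C ?h = Cod C f"
    using fa t n S' by (auto simp: Hom_def)
  have hi: "?h \<cdot> i = f" using fa t n(1) S' by (simp add: Hom_def)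
  have hj: "?h \<cdot> j = n" using fa t n(1) S' by (simp add: Hom_def)
  have "epic C ?h" using epic_of_comp[of ?h i] hi f S' h by simp
  then obtain g where g: "is_cokernel C ?h g" using epic_is_cokernel by blast
  note gD = cokernelD[OF g]
  obtain k where k: "is_kernel C k ?h" using ex_kernel h by blast
  note kD = kernelD[OF k]
  obtain g' where g': "g' \<in> Hom C (Dom C g) (Dom C k)" "k \<cdot> g' = g"
    using kernel_factor[OF k, of g] gD h by auto
  have k1: "k \<in> Arr C" "Cod C k = S" using kD h by auto
  have e: "epic C (q \<cdot> k)"
  proof (rule epicI)
    fix u assume u: "u \<in> Arr C" "Dom C u = Cod C (q \<cdot> k)"
      "u \<cdot> (q \<cdot> k) = Zero C (Dom C (q \<cdot> k)) (Cod C u)"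
    have "(u \<cdot> q) \<cdot> g = (u \<cdot> (q \<cdot> k)) \<cdot> g'"
      using u(1,2) S' k1 g' by (auto simp: Hom_def)
    also have "\<dots> = Zero C (Dom C g) (Cod C u)" using u S' k1 g' by (auto simp: Hom_def)
    finally obtain w where w: "w \<in> Hom C (Cod C f) (Cod C u)" "w \<cdot> ?h = u \<cdot> q"
      using cokernel_factor[OF g, of "u \<cdot> q"] gD S' u k1 h by (auto simp: Hom_def)
    have "w \<cdot> f = w \<cdot> (?h \<cdot> i)" using hi by simp
    also have "\<dots> = (u \<cdot> q) \<cdot> i" using w S' h u(1,2) k1
      by (intro Comp_rewrite) (auto simp: Hom_def)
    also have "\<dots> = Zero C (Cod C f) (Cod C u) \<cdot> f" using S' u(1,2) k1 fa by simp
    finally have "w = Zero C (Cod C f) (Cod C u)"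
      by (rule epic_cancel[OF f]) (use w u fa in \<open>simp_all add: Hom_def\<close>)
    then have "u \<cdot> q = Zero C S (Cod C u)" using w h u by simp
    then have "(u \<cdot> q) \<cdot> j = Zero C (Dom C t) (Cod C u)" using S' u(1) by simp
    then show "u = Zero C (Cod C (q \<cdot> k)) (Cod C u)" using S' u(1,2) k1 by simp
  qed (use S' k1 in auto)
  have "f \<cdot> (p \<cdot> k) \<^bold>+ n \<cdot> (q \<cdot> k) = ?h \<cdot> k"
    using fa n(1) S' k1 t by (simp add: Hom_def)
  also have "\<dots> = Zero C (Dom C k) (Cod C t)" using kD t h by simp
  also have "\<dots> = (n \<^bold>+ t) \<cdot> (q \<cdot> k)" using n(2) S' k1 t fa by simp
  also have "\<dots> = t \<cdot> (q \<cdot> k) \<^bold>+ n \<cdot> (q \<cdot> k)"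
    using n(1) S' k1 t by (simp add: Hom_def) (simp add: Add_commute)
  finally have "f \<cdot> (p \<cdot> k) = t \<cdot> (q \<cdot> k)"
    by (rule Add_cancel[of _ _ _ "Dom C k" "Cod C t"]) (use fa n(1) S' k1 t in \<open>simp_all add: Hom_def\<close>)
  then show ?thesis
    using e S' k1 by (intro that[of "q \<cdot> k" "p \<cdot> k"]) (auto simp: Hom_def)
qed

text \<open>Factoring through a monic may be tested after refinement along an epimorphism:
  \<open>m\<close> is the kernel of some \<open>h\<close>, and \<open>h \<cdot> t\<close> vanishes
  because it vanishes after the epic \<open>e\<close>.\<close>

lemma monic_factor:
  assumes "monic C m" "epic C e" "m \<in> Hom C A Y" "t \<in> Hom C T Y" "e \<in> Hom C T' T"
    "a \<in> Hom C T' A" "t \<cdot> e = m \<cdot> a"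
  shows "\<exists>a' \<in> Hom C T A. t = m \<cdot> a'"
proof -
  obtain h where h: "is_kernel C m h" using monic_is_kernel assms by blast
  note hD = kernelD[OF h]
  have "(h \<cdot> t) \<cdot> e = h \<cdot> (m \<cdot> a)" using assms hD by (simp add: Hom_def flip: assms(7))
  also have "\<dots> = Zero C T (Cod C h) \<cdot> e"
    using Comp_rewrite[OF hD(4), of a] assms hD by (auto simp: Hom_def)
  finally have "h \<cdot> t = Zero C T (Cod C h)"
    by (rule epic_cancel[OF assms(2)]) (use assms hD HomD(4)[OF assms(4)] in \<open>simp_all add: Hom_def\<close>)
  then obtain a' where "a' \<in> Hom C T A" "m \<cdot> a' = t"
    using kernel_factor[OF h, of t] assms hD by (auto simp: Hom_def)
  then show ?thesis by blast
qed

text \<open>Exactness is tested on generalised elements, after refinement along an epimorphism.\<close>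

lemma kernelI:
  assumes f: "f \<in> Hom C A Y" and g: "g \<in> Hom C Y B" and gf: "g \<cdot> f = Zero C A B" and m: "monic C f"
    and ex: "\<And>t. t \<in> Arr C \<Longrightarrow> Cod C t = Y \<Longrightarrow> g \<cdot> t = Zero C (Dom C t) B \<Longrightarrow>
      \<exists>e a. epic C e \<and> e \<in> Arr C \<and> Cod C e = Dom C t \<and> a \<in> Hom C (Dom C e) A \<and> t \<cdot> e = f \<cdot> a"
  shows "is_kernel C f g"
  unfolding is_kernel_def
proof (intro conjI ballI impI)
  fix T t assume T: "T \<in> Ob C" and t: "t \<in> Hom C T (Dom C g)" "g \<cdot> t = Zero C T (Cod C g)"
  obtain e a where ea: "epic C e" "e \<in> Arr C" "Cod C e = T" "a \<in> Hom C (Dom C e) A" "t \<cdot> e = f \<cdot> a"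
    using ex[of t] t g by (auto simp: Hom_def)
  obtain a' where "a' \<in> Hom C T A" "t = f \<cdot> a'"
    using monic_factor[OF m ea(1) f, of t T "Dom C e" a] t g ea by (auto simp: Hom_def)
  moreover have "h = h'" if "h \<in> Hom C T A" "h' \<in> Hom C T A" "f \<cdot> h = f \<cdot> h'" for h h'
    using m that T f unfolding monic_def by (auto simp: Hom_def)
  ultimately show "\<exists>!h. h \<in> Hom C T (Dom C f) \<and> f \<cdot> h = t" using f by (metis HomD(2))
qed (use f g gf in \<open>simp_all add: Hom_def\<close>)

text \<open>An epimorphism is the cokernel of its kernel: \<open>g\<close> is the cokernel of some
  \<open>h\<close>, which factors through \<open>f\<close>, so whatever kills \<open>f\<close> also
  kills \<open>h\<close> and factors through \<open>g\<close>.\<close>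

lemma short_exact_iff:
  "short_exact C A f Y g B \<longleftrightarrow> f \<in> Hom C A Y \<and> g \<in> Hom C Y B \<and> is_kernel C f g \<and> epic C g"
proof
  assume "short_exact C A f Y g B"
  then show "f \<in> Hom C A Y \<and> g \<in> Hom C Y B \<and> is_kernel C f g \<and> epic C g"
    using cokernel_epic by (auto simp: short_exact_def)
next
  assume a: "f \<in> Hom C A Y \<and> g \<in> Hom C Y B \<and> is_kernel C f g \<and> epic C g"
  then obtain h where h: "is_cokernel C g h" using epic_is_cokernel by blast
  note hD = cokernelD[OF h]
  obtain h' where h': "h' \<in> Hom C (Dom C h) A" "f \<cdot> h' = h"
    using kernel_factor[of f g h] a hD by (auto simp: Hom_def)
  have "is_cokernel C g f"
    unfolding is_cokernel_def
  proof (intro conjI ballI impI)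
    show "g \<cdot> f = Zero C (Dom C f) (Cod C g)" using a kernelD by blast
    fix T t assume T: "T \<in> Ob C" and t: "t \<in> Hom C (Cod C f) T" "t \<cdot> f = Zero C (Dom C f) T"
    have "t \<cdot> h = Zero C (Dom C f) T \<cdot> h'"
      unfolding h'(2)[symmetric] using t h' a by (intro Comp_rewrite) (auto simp: Hom_def)
    also have "\<dots> = Zero C (Dom C h) T" using h' a T by (auto simp: Hom_def)
    finally obtain u where "u \<in> Hom C (Cod C g) T" "u \<cdot> g = t"
      using cokernel_factor[OF h, of t] t a hD by (auto simp: Hom_def)
    moreover have "u = u'" if "u \<in> Hom C (Cod C g) T" "u' \<in> Hom C (Cod C g) T" "u \<cdot> g = u' \<cdot> g" for u u'
      using a that T unfolding epic_def by auto
    ultimately show "\<exists>!u. u \<in> Hom C (Cod C g) T \<and> u \<cdot> g = t" by blast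
  qed (use a in \<open>simp_all add: Hom_def\<close>)
  with a show "short_exact C A f Y g B" by (auto simp: short_exact_def)
qed

text \<open>Dual to the preceding argument: \<open>m\<close> is the kernel of some \<open>h\<close>,
  and \<open>h\<close> factors through \<open>c\<close>, so whatever \<open>c\<close> kills is
  killed by \<open>h\<close>.\<close>

lemma monic_kernel_of_cokernel:
  assumes "monic C m" "is_cokernel C c m"
  shows "is_kernel C m c"
proof -
  obtain h where h: "is_kernel C m h" using monic_is_kernel assms by blast
  note hD = kernelD[OF h] and cD = cokernelD[OF assms(2)]
  obtain h' where h': "h' \<in> Hom C (Cod C c) (Cod C h)" "h' \<cdot> c = h"
    using cokernel_factor[OF assms(2), of h] hD by auto
  show ?thesis
  proof (rule kernelI)
    show "m \<in> Hom C (Dom C m) (Cod C m)" "c \<in> Hom C (Cod C m) (Cod C c)"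
      "c \<cdot> m = Zero C (Dom C m) (Cod C c)" "monic C m" using cD assms by auto
    fix t assume t: "t \<in> Arr C" "Cod C t = Cod C m" "c \<cdot> t = Zero C (Dom C t) (Cod C c)"
    have "h \<cdot> t = h' \<cdot> (c \<cdot> t)" unfolding h'(2)[symmetric] using t h' cD by (auto simp: Hom_def)
    also have "\<dots> = Zero C (Dom C t) (Cod C h)" using t(1,3) h' by (auto simp: Hom_def)
    finally obtain a where "a \<in> Hom C (Dom C t) (Dom C m)" "m \<cdot> a = t"
      using kernel_factor[OF h t(1)] t hD by auto
    then show "\<exists>e a. epic C e \<and> e \<in> Arr C \<and> Cod C e = Dom C t \<and> a \<in> Hom C (Dom C e) (Dom C m) \<and>
        t \<cdot> e = m \<cdot> a"
      \<comment> \<open>The factorisation exists without refinement, so the refining epimorphism is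
        the identity.\<close>
      by (intro exI[of _ "Id C (Dom C t)"] exI[of _ a]) (use t epic_Id in auto)
  qed
qed

end

section \<open>Splitting short exact sequences along biproducts\<close>

context abelian_category
begin

lemma short_exactD:
  assumes "short_exact C A f Y g B"
  shows "f \<in> Arr C" "Dom C f = A" "Cod C f = Y" "g \<in> Arr C" "Dom C g = Y" "Cod C g = B"
    "A \<in> Ob C" "Y \<in> Ob C" "B \<in> Ob C" "is_kernel C f g" "epic C g"
    "g \<cdot> f = Zero C A B"
    "\<And>x. x \<in> Arr C \<Longrightarrow> Cod C x = A \<Longrightarrow> g \<cdot> (f \<cdot> x) = Zero C (Dom C x) B"
proof -
  have h: "f \<in> Hom C A Y" "g \<in> Hom C Y B" "is_kernel C f g" "epic C g"
    using assms by (auto simp: short_exact_iff)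
  then show 1: "f \<in> Arr C" "Dom C f = A" "Cod C f = Y" "g \<in> Arr C" "Dom C g = Y" "Cod C g = B"
    "A \<in> Ob C" "Y \<in> Ob C" "B \<in> Ob C" "is_kernel C f g" "epic C g" by auto
  show 2: "g \<cdot> f = Zero C A B" using kernelD(4)[OF h(3)] 1 by simp
  show "g \<cdot> (f \<cdot> x) = Zero C (Dom C x) B" if "x \<in> Arr C" "Cod C x = A" for x
    using Comp_rewrite[OF 2, of x] 1 that by simp
qed

text \<open>The object \<open>Cod C c\<close> is the quotient Y/A2, which is the pushout of the
  extension along the projection \<open>p\<close> of \<open>A\<close> to \<open>A1\<close>. The new
  left-hand map is monic because \<open>A1\<close> and \<open>A2\<close> meet in zero inside
  \<open>A\<close>.\<close>

lemma short_exact_quotient_summand: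
  assumes se: "short_exact C A f Y g B" and b: "biproduct A1 A2 A i p j q"
    and c: "is_cokernel C c (f \<cdot> j)"
  shows "\<exists>g1. short_exact C A1 (c \<cdot> (f \<cdot> i)) (Cod C c) g1 B \<and> g1 \<cdot> c = g \<and> monic C (f \<cdot> j)"
proof -
  note s = short_exactD[OF se] and b' = biproductD[OF b]
  have c': "c \<in> Arr C" "Dom C c = Y" "c \<cdot> (f \<cdot> j) = Zero C A2 (Cod C c)"
    using cokernelD[OF c] s b' by simp_all
  have cfj: "c \<cdot> (f \<cdot> (j \<cdot> x)) = Zero C (Dom C x) (Cod C c)" if "x \<in> Arr C" "Cod C x = A2" for x
    using Comp_rewrite[OF c'(3), of x] c' s b' that by simp
  obtain g1 where g1: "g1 \<in> Hom C (Cod C c) B" "g1 \<cdot> c = g"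
    using cokernel_factor[OF c, of g] s b' by (auto simp: Hom_def)
  have g1c: "g1 \<cdot> (c \<cdot> x) = g \<cdot> x" if "x \<in> Arr C" "Cod C x = Y" for x
    using Comp_rewrite[OF g1(2), of x] g1 c' s that by auto
  have mon: "monic C (f \<cdot> j)"
  proof (rule monicI)
    fix t assume t: "t \<in> Arr C" "Cod C t = Dom C (f \<cdot> j)"
      "f \<cdot> j \<cdot> t = Zero C (Dom C t) (Cod C (f \<cdot> j))"
    have "j \<cdot> t = Zero C (Dom C t) A"
      using monic_cancel_zero[OF kernel_monic[OF s(10)], of "j \<cdot> t"] t s b' by simp
    then have "q \<cdot> (j \<cdot> t) = Zero C (Dom C t) A2" using s b' t by simp
    then show "t = Zero C (Dom C t) (Dom C (f \<cdot> j))" using t s b' by simp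
  qed (use s b' in auto)
  then have ker: "is_kernel C (f \<cdot> j) c" using c by (rule monic_kernel_of_cokernel)
  have "is_kernel C (c \<cdot> (f \<cdot> i)) g1"
  proof (rule kernelI)
    show "c \<cdot> (f \<cdot> i) \<in> Hom C A1 (Cod C c)" using c' s b' by auto
    show "g1 \<in> Hom C (Cod C c) B" by fact
    show "g1 \<cdot> (c \<cdot> (f \<cdot> i)) = Zero C A1 B" using s b' by (simp add: g1c)
    show "monic C (c \<cdot> (f \<cdot> i))"
    proof (rule monicI)
      fix t assume t: "t \<in> Arr C" "Cod C t = Dom C (c \<cdot> (f \<cdot> i))"
        "c \<cdot> (f \<cdot> i) \<cdot> t = Zero C (Dom C t) (Cod C (c \<cdot> (f \<cdot> i)))"
      then obtain a where a: "a \<in> Hom C (Dom C t) A2" "f \<cdot> j \<cdot> a = f \<cdot> (i \<cdot> t)"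
        using kernel_factor[OF ker, of "f \<cdot> (i \<cdot> t)"] c' s b' by auto
      have "j \<cdot> a = i \<cdot> t"
        by (rule kernel_cancel[OF s(10)]) (use a t s b' c' in \<open>simp_all add: Hom_def\<close>)
      then have "p \<cdot> (j \<cdot> a) = p \<cdot> (i \<cdot> t)" by simp
      then show "t = Zero C (Dom C t) (Dom C (c \<cdot> (f \<cdot> i)))"
        using a t s b' c' by (auto simp: Hom_def)
    qed (use c' s b' in auto)
    fix t assume t: "t \<in> Arr C" "Cod C t = Cod C c" "g1 \<cdot> t = Zero C (Dom C t) B"
    \<comment> \<open>A representative in \<open>Y\<close> of an element of the quotient exists only
      after refinement.\<close>
    obtain e y where e: "epic C e" "e \<in> Arr C" "Cod C e = Dom C t"
      "y \<in> Hom C (Dom C e) Y" "t \<cdot> e = c \<cdot> y"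
      using epic_pullback[OF cokernel_epic[OF c] t(1,2)] c' by metis
    have "g \<cdot> y = g1 \<cdot> (t \<cdot> e)" using e g1c by (auto simp: Hom_def)
    also have "\<dots> = Zero C (Dom C t) B \<cdot> e"
      using t e g1 by (intro Comp_rewrite) (auto simp: Hom_def)
    also have "\<dots> = Zero C (Dom C e) B" using e s by simp
    finally obtain a where a: "a \<in> Hom C (Dom C e) A" "f \<cdot> a = y"
      using kernel_factor[OF s(10), of y] s e by (auto simp: Hom_def)
    have pa: "p \<cdot> a \<in> Hom C (Dom C e) A1" "q \<cdot> a \<in> Hom C (Dom C e) A2"
      using a b' by (auto simp: Hom_def)
    \<comment> \<open>Of the two components of \<open>a\<close>, the one in \<open>A2\<close> dies
      in the quotient, so only \<open>p \<cdot> a\<close> matters.\<close>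
    have "t \<cdot> e = c \<cdot> (f \<cdot> (i \<cdot> (p \<cdot> a) \<^bold>+ j \<cdot> (q \<cdot> a)))"
      using biproduct_decompose[OF b, of a] a e by (auto simp: Hom_def)
    also have "\<dots> = c \<cdot> (f \<cdot> (i \<cdot> (p \<cdot> a))) \<^bold>+ c \<cdot> (f \<cdot> (j \<cdot> (q \<cdot> a)))"
      using c' s b' pa a by (auto simp: Hom_def)
    also have "\<dots> = c \<cdot> (f \<cdot> i) \<cdot> (p \<cdot> a)"
      using c' s b' pa a by (auto simp: Hom_def cfj)
    finally show "\<exists>e a. epic C e \<and> e \<in> Arr C \<and> Cod C e = Dom C t \<and> a \<in> Hom C (Dom C e) A1 \<and>
        t \<cdot> e = c \<cdot> (f \<cdot> i) \<cdot> a"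
      using e pa by blast
  qed
  moreover have "epic C g1" using epic_of_comp[of g1 c] g1 c' s by (simp add: Hom_def)
  moreover have "c \<cdot> (f \<cdot> i) \<in> Hom C A1 (Cod C c)" using c' s b' by auto
  ultimately show ?thesis using g1 mon short_exact_iff by blast
qed

text \<open>Here Y1 is Y/A2 and Y2 is Y/A1, with quotient maps \<open>c\<close> and
  \<open>d\<close>. The map from \<open>Y\<close> to their sum is monic because \<open>A1\<close>
  and \<open>A2\<close> meet in zero. For exactness, lifts to \<open>Y\<close> of two elements with
  the same image in \<open>B\<close> differ by an element of \<open>A\<close>, whose two components
  can be distributed over the two lifts.\<close>

lemma short_exact_split_left:
  assumes se: "short_exact C A f Y g B" and A: "direct_sum C [A1, A2] A"
  shows "\<exists>Y1 f1 g1 Y2 f2 g2 S k h. short_exact C A1 f1 Y1 g1 B \<and> short_exact C A2 f2 Y2 g2 B \<and>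
    direct_sum C [Y1, Y2] S \<and> short_exact C Y k S h B"
proof -
  obtain i p j q where b: "biproduct A1 A2 A i p j q" using A direct_sum_pair by blast
  note s = short_exactD[OF se] and b' = biproductD[OF b]
  obtain c where c: "is_cokernel C c (f \<cdot> j)" using ex_cokernel[of "f \<cdot> j"] s b' by auto
  obtain d where d: "is_cokernel C d (f \<cdot> i)" using ex_cokernel[of "f \<cdot> i"] s b' by auto
  obtain g1 where g1: "short_exact C A1 (c \<cdot> (f \<cdot> i)) (Cod C c) g1 B" "g1 \<cdot> c = g" "monic C (f \<cdot> j)"
    using short_exact_quotient_summand[OF se b c] by blast
  obtain g2 where g2: "short_exact C A2 (d \<cdot> (f \<cdot> j)) (Cod C d) g2 B" "g2 \<cdot> d = g" "monic C (f \<cdot> i)"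
    using short_exact_quotient_summand[OF se biproduct_swap[OF b] d] by blast
  note s1 = short_exactD(4-6,8,11)[OF g1(1)] and s2 = short_exactD(4-6,8,11)[OF g2(1)]
  have c': "c \<in> Arr C" "Dom C c = Y" "c \<cdot> (f \<cdot> j) = Zero C A2 (Cod C c)"
    using cokernelD[OF c] s b' by simp_all
  have d': "d \<in> Arr C" "Dom C d = Y" "d \<cdot> (f \<cdot> i) = Zero C A1 (Cod C d)"
    using cokernelD[OF d] s b' by simp_all
  have cfj: "c \<cdot> (f \<cdot> (j \<cdot> x)) = Zero C (Dom C x) (Cod C c)" if "x \<in> Arr C" "Cod C x = A2" for x
    using Comp_rewrite[OF c'(3), of x] c' s b' that by simp
  have dfi: "d \<cdot> (f \<cdot> (i \<cdot> x)) = Zero C (Dom C x) (Cod C d)" if "x \<in> Arr C" "Cod C x = A1" for x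
    using Comp_rewrite[OF d'(3), of x] d' s b' that by simp
  have g1c: "g1 \<cdot> (c \<cdot> x) = g \<cdot> x" if "x \<in> Arr C" "Cod C x = Y" for x
    using Comp_rewrite[OF g1(2), of x] s1 c' s that by auto
  have g2d: "g2 \<cdot> (d \<cdot> x) = g \<cdot> x" if "x \<in> Arr C" "Cod C x = Y" for x
    using Comp_rewrite[OF g2(2), of x] s2 d' s that by auto
  obtain S k l u v where S: "biproduct (Cod C c) (Cod C d) S k u l v"
    using ex_direct_sum[of "Cod C c" "Cod C d"] c' d' by (auto simp: direct_sum_pair)
  note S' = biproductD[OF S]
  \<comment> \<open>\<open>n\<close> is the negative of \<open>g2\<close>, so the kernel of
    \<open>?h\<close> is the fibre product of \<open>g1\<close> and \<open>g2\<close>.\<close>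
  obtain n where n: "n \<in> Hom C (Cod C d) B" "n \<^bold>+ g2 = Zero C (Cod C d) B"
    using ex_negative[of g2 "Cod C d" B] s2 by blast
  have ng2: "n \<cdot> x \<^bold>+ g2 \<cdot> x = Zero C (Dom C x) B" if "x \<in> Arr C" "Cod C x = Cod C d" for x
  proof -
    have "n \<cdot> x \<^bold>+ g2 \<cdot> x = (n \<^bold>+ g2) \<cdot> x" using n(1) that s2 by (simp add: Hom_def)
    then show ?thesis using n that s by simp
  qed
  let ?h = "g1 \<cdot> u \<^bold>+ n \<cdot> v" and ?m = "k \<cdot> c \<^bold>+ l \<cdot> d"
  have h: "?h \<in> Hom C S B" using S' s1 n(1) by (auto simp: Hom_def)
  have m: "?m \<in> Hom C Y S" using S' c' d' by (auto simp: Hom_def)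
  have hk: "?h \<cdot> k = g1" using S' s1 n(1) s by (simp add: Hom_def)
  have epi: "epic C ?h" using epic_of_comp[of ?h k] hk s1 S' h by (simp add: Hom_def)
  have um: "u \<cdot> (?m \<cdot> x) = c \<cdot> x" "v \<cdot> (?m \<cdot> x) = d \<cdot> x" if "x \<in> Arr C" "Cod C x = Y" for x
    using that S' c' d' by simp_all
  have "is_kernel C ?m ?h"
  proof (rule kernelI[OF m h])
    have "?h \<cdot> ?m = g \<^bold>+ n \<cdot> d"
      using S' s1 n(1) c' d' g1(2) s by (simp add: Hom_def)
    also have "\<dots> = n \<cdot> d \<^bold>+ g2 \<cdot> d" using n(1) d' s g2(2) by (subst Add_commute) (auto simp: Hom_def)
    also have "\<dots> = Zero C Y B" using ng2[of d] d' by simp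
    finally show "?h \<cdot> ?m = Zero C Y B" .
    show "monic C ?m"
    proof (rule monicI)
      fix t assume t: "t \<in> Arr C" "Cod C t = Dom C ?m" "?m \<cdot> t = Zero C (Dom C t) (Cod C ?m)"
      have t': "Cod C t = Y" using t m by auto
      \<comment> \<open>Killed by both \<open>c\<close> and \<open>d\<close>, the arrow
        \<open>t\<close> comes from \<open>A2\<close> and from \<open>A1\<close>; comparing the two
        in \<open>A\<close> shows that it is zero.\<close>
      have "c \<cdot> t = Zero C (Dom C t) (Cod C c)"
        using um(1)[of t] t(1,3) t' S' m by (auto simp: Hom_def)
      then obtain a where a: "a \<in> Hom C (Dom C t) A2" "f \<cdot> j \<cdot> a = t"
        using kernel_factor[OF monic_kernel_of_cokernel[OF g1(3) c], of t] t t' s b' c' by auto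
      have "d \<cdot> t = Zero C (Dom C t) (Cod C d)"
        using um(2)[of t] t(1,3) t' S' m by (auto simp: Hom_def)
      then obtain a' where a': "a' \<in> Hom C (Dom C t) A1" "f \<cdot> i \<cdot> a' = t"
        using kernel_factor[OF monic_kernel_of_cokernel[OF g2(3) d], of t] t t' s b' d' by auto
      have "f \<cdot> (j \<cdot> a) = f \<cdot> (i \<cdot> a')" using a a' s b' by (auto simp: Hom_def)
      then have "j \<cdot> a = i \<cdot> a'"
        by (rule kernel_cancel[OF s(10)]) (use a a' s b' in \<open>simp_all add: Hom_def\<close>)
      then have "q \<cdot> (j \<cdot> a) = q \<cdot> (i \<cdot> a')" by simp
      then have "a = Zero C (Dom C t) A2" using a(1) a'(1) b' by (auto simp: Hom_def)
      then show "t = Zero C (Dom C t) (Dom C ?m)" using a(2) t t' s b' m by auto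
    qed (use m in auto)
    fix t assume t: "t \<in> Arr C" "Cod C t = S" "?h \<cdot> t = Zero C (Dom C t) B"
    have ut: "u \<cdot> t \<in> Arr C" "Cod C (u \<cdot> t) = Cod C c" "Dom C (u \<cdot> t) = Dom C t"
      and vt: "v \<cdot> t \<in> Arr C" "Cod C (v \<cdot> t) = Cod C d" "Dom C (v \<cdot> t) = Dom C t"
      using t S' by auto
    have "g1 \<cdot> (u \<cdot> t) \<^bold>+ n \<cdot> (v \<cdot> t) = ?h \<cdot> t" using t S' s1 n(1) by (simp add: Hom_def)
    also have "\<dots> = g2 \<cdot> (v \<cdot> t) \<^bold>+ n \<cdot> (v \<cdot> t)"
      using ng2[of "v \<cdot> t"] t S' s2 n(1) by (subst Add_commute) (auto simp: Hom_def)
    finally have g12: "g1 \<cdot> (u \<cdot> t) = g2 \<cdot> (v \<cdot> t)"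
      by (rule Add_cancel[of _ _ _ "Dom C t" B]) (use ut vt s1 s2 n(1) in \<open>simp_all add: Hom_def\<close>)
    \<comment> \<open>The components \<open>u \<cdot> t\<close> and \<open>v \<cdot> t\<close> are
      lifted to \<open>Y\<close> in turn, \<open>e'\<close> refining \<open>e\<close>
      further.\<close>
    obtain e y where e: "epic C e" "e \<in> Arr C" "Cod C e = Dom C t"
      "y \<in> Hom C (Dom C e) Y" "u \<cdot> t \<cdot> e = c \<cdot> y"
      using epic_pullback[OF cokernel_epic[OF c] ut(1,2)] c' ut(3) by metis
    have ve: "v \<cdot> t \<cdot> e \<in> Arr C" "Cod C (v \<cdot> t \<cdot> e) = Cod C d" "Dom C (v \<cdot> t \<cdot> e) = Dom C e"
      using e vt by auto
    obtain e' z where e': "epic C e'" "e' \<in> Arr C" "Cod C e' = Dom C e"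
      "z \<in> Hom C (Dom C e') Y" "v \<cdot> t \<cdot> e \<cdot> e' = d \<cdot> z"
      using epic_pullback[OF cokernel_epic[OF d] ve(1,2)] d' ve(3) by metis
    have y': "y \<in> Arr C" "Dom C y = Dom C e" "Cod C y = Y"
      and z': "z \<in> Arr C" "Dom C z = Dom C e'" "Cod C z = Y" using e e' by auto
    have "g \<cdot> (y \<cdot> e') = g1 \<cdot> (c \<cdot> (y \<cdot> e'))" using g1c y' e' by simp
    also have "c \<cdot> (y \<cdot> e') = u \<cdot> t \<cdot> e \<cdot> e'" using c' y' e' by (simp add: e(5))
    also have "g1 \<cdot> (u \<cdot> t \<cdot> e \<cdot> e') = g1 \<cdot> (u \<cdot> t) \<cdot> (e \<cdot> e')"
      using s1 t S' e(1-3) e'(1-3) by simp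
    also have "\<dots> = g2 \<cdot> (v \<cdot> t \<cdot> e \<cdot> e')" unfolding g12 using s2 t S' e(1-3) e'(1-3) by simp
    also have "\<dots> = g \<cdot> z" using e' z' g2d by simp
    finally have gyz: "g \<cdot> (y \<cdot> e') = g \<cdot> z" .
    \<comment> \<open>\<open>w\<close> is the negative of \<open>z\<close>; the two lifts agree in
      \<open>B\<close>, so their difference comes from \<open>A\<close>.\<close>
    obtain w where w: "w \<in> Hom C (Dom C e') Y" "w \<^bold>+ z = Zero C (Dom C e') Y"
      using ex_negative[OF e'(4)] .
    have "g \<cdot> (w \<^bold>+ y \<cdot> e') = g \<cdot> (w \<^bold>+ z)"
      using w(1) y' z' e' s gyz by (simp add: Hom_def)
    also have "\<dots> = Zero C (Dom C e') B" using w s e' by simp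
    finally obtain a where a: "a \<in> Hom C (Dom C e') A" "f \<cdot> a = w \<^bold>+ y \<cdot> e'"
      using kernel_factor[OF s(10), of "w \<^bold>+ y \<cdot> e'"] s w(1) y' e' by (auto simp: Hom_def)
    have pa: "p \<cdot> a \<in> Arr C" "Dom C (p \<cdot> a) = Dom C e'" "Cod C (p \<cdot> a) = A1"
      "q \<cdot> a \<in> Arr C" "Dom C (q \<cdot> a) = Dom C e'" "Cod C (q \<cdot> a) = A2"
      "a \<in> Arr C" "Dom C a = Dom C e'" "Cod C a = A"
      using a b' by (auto simp: Hom_def)
    \<comment> \<open>The lift \<open>z\<close> is corrected by the \<open>A1\<close>-part of the
      difference. \<open>d\<close> kills that part, so \<open>d\<close> sees only \<open>z\<close>;
      \<open>c\<close> kills the remaining \<open>A2\<close>-part, so \<open>c\<close> cannot tell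
      \<open>?x\<close> from \<open>y \<cdot> e'\<close>.\<close>
    let ?x = "z \<^bold>+ f \<cdot> (i \<cdot> (p \<cdot> a))"
    have x: "?x \<in> Hom C (Dom C e') Y" using z' s b' pa by auto
    have "f \<cdot> a = f \<cdot> (i \<cdot> (p \<cdot> a) \<^bold>+ j \<cdot> (q \<cdot> a))"
      using biproduct_decompose[OF b pa(7,9)] by simp
    also have "\<dots> = f \<cdot> (i \<cdot> (p \<cdot> a)) \<^bold>+ f \<cdot> (j \<cdot> (q \<cdot> a))" using s b' pa by simp
    finally have fa: "f \<cdot> a = f \<cdot> (i \<cdot> (p \<cdot> a)) \<^bold>+ f \<cdot> (j \<cdot> (q \<cdot> a))" .
    have cfa: "c \<cdot> (f \<cdot> a) = c \<cdot> (f \<cdot> (i \<cdot> (p \<cdot> a)))"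
      unfolding fa using s b' pa(1-6) c' cfj by simp
    have "z \<^bold>+ f \<cdot> a = (w \<^bold>+ z) \<^bold>+ y \<cdot> e'"
      unfolding a(2) using w(1) y' z' e'
      by (subst Add_assoc[symmetric]) (auto simp: Hom_def Add_commute)
    also have "\<dots> = y \<cdot> e'" using w y' e' by simp
    finally have "c \<cdot> (z \<^bold>+ f \<cdot> a) = c \<cdot> (y \<cdot> e')" by simp
    also have "\<dots> = u \<cdot> t \<cdot> e \<cdot> e'" using c' y' e' by (simp add: e(5))
    also have "c \<cdot> (z \<^bold>+ f \<cdot> a) = c \<cdot> ?x"
      using c' z' s pa b' cfa by simp
    finally have cx: "c \<cdot> ?x = u \<cdot> t \<cdot> e \<cdot> e'" .
    have dx: "d \<cdot> ?x = v \<cdot> t \<cdot> e \<cdot> e'"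
      using d' z' s pa(1-3) b' dfi by (simp add: e'(5))
    have "?m \<cdot> ?x = k \<cdot> (c \<cdot> ?x) \<^bold>+ l \<cdot> (d \<cdot> ?x)"
      using x c' d' S' by (auto simp: Hom_def simp del: Comp_Add)
    also have "\<dots> = k \<cdot> (u \<cdot> (t \<cdot> (e \<cdot> e'))) \<^bold>+ l \<cdot> (v \<cdot> (t \<cdot> (e \<cdot> e')))"
      unfolding cx dx using t S' e(1-3) e'(1-3) by simp
    also have "\<dots> = t \<cdot> (e \<cdot> e')"
      using biproduct_decompose[OF S, of "t \<cdot> (e \<cdot> e')"] t e e' by simp
    finally have "t \<cdot> (e \<cdot> e') = ?m \<cdot> ?x" by simp
    moreover have "epic C (e \<cdot> e')" using epic_comp e e' by blast
    moreover have "e \<cdot> e' \<in> Arr C" "Cod C (e \<cdot> e') = Dom C t" "Dom C (e \<cdot> e') = Dom C e'"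
      using e e' by auto
    ultimately show "\<exists>e a. epic C e \<and> e \<in> Arr C \<and> Cod C e = Dom C t \<and> a \<in> Hom C (Dom C e) Y \<and>
        t \<cdot> e = ?m \<cdot> a"
      using x by metis
  qed
  then have "short_exact C Y ?m S ?h B" using m h epi by (simp add: short_exact_iff)
  moreover have "direct_sum C [Cod C c, Cod C d] S" using S direct_sum_pair by blast
  ultimately show ?thesis using g1(1) g2(1) by blast
qed

text \<open>\<open>X\<close> is the preimage of \<open>B1\<close> in \<open>Y\<close>, obtained as
  the kernel of \<open>q \<cdot> g\<close>. Both closure proofs use it to shorten the right-hand
  term.\<close>

lemma short_exact_split_right:
  assumes se: "short_exact C A f Y g B" and B: "direct_sum C [B1, B2] B"
  shows "\<exists>X f1 g1 f2 g2. short_exact C A f1 X g1 B1 \<and> short_exact C X f2 Y g2 B2"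
proof -
  obtain i p j q where b: "biproduct B1 B2 B i p j q" using B direct_sum_pair by blast
  note s = short_exactD[OF se] and b' = biproductD[OF b]
  obtain k where k: "is_kernel C k (q \<cdot> g)" using ex_kernel[of "q \<cdot> g"] s b' by auto
  let ?X = "Dom C k"
  have k': "k \<in> Arr C" "Cod C k = Y" "q \<cdot> (g \<cdot> k) = Zero C ?X B2"
    using kernelD[OF k] s b' by simp_all
  have "epic C q"
    using epic_of_comp[of q j] b' epic_Id by simp
  then have epi: "epic C (q \<cdot> g)" using epic_comp[OF s(11)] s b' by simp
  obtain f1 where f1: "f1 \<in> Hom C A ?X" "k \<cdot> f1 = f"
    using kernel_factor[OF k, of f] s b' by auto
  have kf: "k \<cdot> (f1 \<cdot> x) = f \<cdot> x" if "x \<in> Arr C" "Cod C x = A" for x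
    using Comp_rewrite[OF f1(2), of x] f1(1) k' that s by (simp add: Hom_def)
  let ?g = "p \<cdot> (g \<cdot> k)"
  have g: "?g \<in> Hom C ?X B1" using s b' k' by auto
  have "is_kernel C f1 ?g"
  proof (rule kernelI[OF f1(1) g])
    show "?g \<cdot> f1 = Zero C A B1" using s b' k' f1 by (auto simp: Hom_def)
    show "monic C f1"
    proof (rule monicI)
      fix t assume t: "t \<in> Arr C" "Cod C t = Dom C f1" "f1 \<cdot> t = Zero C (Dom C t) (Cod C f1)"
      then have "f \<cdot> t = Zero C (Dom C t) (Cod C f)" using kf[of t] f1(1) k' s by (simp add: Hom_def)
      then show "t = Zero C (Dom C t) (Dom C f1)"
        using monic_cancel_zero[OF kernel_monic[OF s(10)], of t] t f1 s by auto
    qed (use f1 in auto)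
    fix t assume t: "t \<in> Arr C" "Cod C t = ?X" "?g \<cdot> t = Zero C (Dom C t) B1"
    have "q \<cdot> (g \<cdot> k) \<cdot> t = Zero C (Dom C t) B2" unfolding k'(3) using t b' k' by simp
    then have q0: "q \<cdot> (g \<cdot> (k \<cdot> t)) = Zero C (Dom C t) B2" using t b' s k'(1,2) by simp
    have p0: "p \<cdot> (g \<cdot> (k \<cdot> t)) = Zero C (Dom C t) B1" using t b' s k' by simp
    have "g \<cdot> (k \<cdot> t) = i \<cdot> Zero C (Dom C t) B1 \<^bold>+ j \<cdot> Zero C (Dom C t) B2"
      using biproduct_decompose[OF b, of "g \<cdot> (k \<cdot> t)"] t(1,2) k'(1,2) s p0 q0 by simp
    then have "g \<cdot> (k \<cdot> t) = Zero C (Dom C t) B" using b' t(1) by simp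
    then obtain a where a: "a \<in> Hom C (Dom C t) A" "f \<cdot> a = k \<cdot> t"
      using kernel_factor[OF s(10), of "k \<cdot> t"] t k' s by auto
    have "k \<cdot> (f1 \<cdot> a) = k \<cdot> t" using kf[of a] HomD(1,3)[OF a(1)] a(2) by simp
    then have "f1 \<cdot> a = t" by (rule kernel_cancel[OF k]) (use a f1 t in \<open>simp_all add: Hom_def\<close>)
    then show "\<exists>e a. epic C e \<and> e \<in> Arr C \<and> Cod C e = Dom C t \<and> a \<in> Hom C (Dom C e) A \<and>
        t \<cdot> e = f1 \<cdot> a"
      by (intro exI[of _ "Id C (Dom C t)"] exI[of _ a]) (use t a epic_Id in auto)
  qed
  moreover have "epic C ?g"
  proof -
    \<comment> \<open>The inclusion of \<open>B1\<close> is lifted over \<open>g\<close> after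
      refinement by \<open>e\<close>. The lift lands in \<open>?X\<close> because its
      \<open>B2\<close>-component vanishes, and \<open>?g\<close> sends it to the epic
      \<open>e\<close>.\<close>
    obtain e y where e: "epic C e" "e \<in> Arr C" "Cod C e = B1"
      "y \<in> Hom C (Dom C e) Y" "i \<cdot> e = g \<cdot> y"
      using epic_pullback[OF s(11), of i] b' s by metis
    have "q \<cdot> (g \<cdot> y) = Zero C (Dom C e) B2" using e b' by (simp flip: e(5))
    then obtain x where x: "x \<in> Hom C (Dom C e) ?X" "k \<cdot> x = y"
      using kernel_factor[OF k, of y] e s b' by (auto simp: Hom_def)
    have "?g \<cdot> x = p \<cdot> (g \<cdot> y)" using x s b' k' by (auto simp: Hom_def)
    also have "\<dots> = e" using e b' by (simp flip: e(5))
    finally show ?thesis using epic_of_comp[of ?g x] e(1) x(1) g by (simp add: Hom_def)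
  qed
  ultimately have "short_exact C A f1 ?X ?g B1" using f1 g by (simp add: short_exact_iff)
  moreover have "short_exact C ?X k Y (q \<cdot> g) B2"
    using k epi k' s b' by (auto simp: short_exact_iff)
  ultimately show ?thesis by blast
qed

text \<open>Opens families to induction. \<open>T\<close> is a complement of the retract
  \<open>A\<close>, and the remaining structure maps are composed with the maps \<open>q\<close> and
  \<open>j\<close> of \<open>T\<close>.\<close>

lemma direct_sum_ConsD:
  assumes "direct_sum C (A # As) S"
  shows "\<exists>T. direct_sum C As T \<and> direct_sum C [A, T] S"
proof -
  obtain \<iota> \<pi> where ob: "set (A # As) \<subseteq> Ob C" "S \<in> Ob C"
    and hom: "\<forall>k < Suc (length As). \<iota> k \<in> Hom C ((A # As) ! k) S \<and> \<pi> k \<in> Hom C S ((A # As) ! k)"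
    and eq: "\<forall>l < Suc (length As). \<forall>k < Suc (length As). \<pi> l \<cdot> \<iota> k = (if l = k then Id C ((A # As) ! k)
      else Zero C ((A # As) ! k) ((A # As) ! l))"
    and s: "finprod (hom_group C S S) (\<lambda>k. \<iota> k \<cdot> \<pi> k) {..<Suc (length As)} = Id C S"
    using assms unfolding direct_sum_def length_Cons by blast
  have "\<iota> 0 \<in> Hom C A S" "\<pi> 0 \<in> Hom C S A" "\<pi> 0 \<cdot> \<iota> 0 = Id C A" using hom eq by auto
  then obtain T j q where b: "biproduct A T S (\<iota> 0) (\<pi> 0) j q" using retract_biproduct by blast
  note b' = biproductD[OF b]
  define I where "I k = q \<cdot> \<iota> (Suc k)" for k
  define P where "P k = \<pi> (Suc k) \<cdot> j" for k
  have h: "\<iota> (Suc k) \<in> Arr C" "Dom C (\<iota> (Suc k)) = As ! k" "Cod C (\<iota> (Suc k)) = S"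
    "\<pi> (Suc k) \<in> Arr C" "Dom C (\<pi> (Suc k)) = S" "Cod C (\<pi> (Suc k)) = As ! k" "As ! k \<in> Ob C"
    if "k < length As" for k
    using hom that ob by (auto simp: Hom_def)
  have IP: "I k \<in> Hom C (As ! k) T \<and> P k \<in> Hom C T (As ! k)" if "k < length As" for k
    using h[OF that] b' unfolding I_def P_def by auto
  have PI: "P l \<cdot> I k = (if l = k then Id C (As ! k) else Zero C (As ! k) (As ! l))"
    if l: "l < length As" and k: "k < length As" for l k
  proof -
    \<comment> \<open>The later injections have no component in \<open>A\<close>, so nothing is lost
      when they pass through \<open>T\<close>.\<close>
    have \<pi>\<iota>: "\<pi> 0 \<cdot> \<iota> (Suc k) = Zero C (As ! k) A" using eq that by auto
    have "\<iota> (Suc k) = \<iota> 0 \<cdot> (\<pi> 0 \<cdot> \<iota> (Suc k)) \<^bold>+ j \<cdot> (q \<cdot> \<iota> (Suc k))"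
      using biproduct_decompose[OF b, of "\<iota> (Suc k)"] h[OF k] by simp
    also have "\<dots> = j \<cdot> (q \<cdot> \<iota> (Suc k))" unfolding \<pi>\<iota> using b' h[OF k] by simp
    finally have "\<pi> (Suc l) \<cdot> \<iota> (Suc k) = \<pi> (Suc l) \<cdot> (j \<cdot> (q \<cdot> \<iota> (Suc k)))" by simp
    then have "P l \<cdot> I k = \<pi> (Suc l) \<cdot> \<iota> (Suc k)"
      unfolding P_def I_def using b' h[OF k] h[OF l] by simp
    then show ?thesis using eq that by auto
  qed
  have hom0: "\<iota> k \<cdot> \<pi> k \<in> Hom C S S" if "k < Suc (length As)" for k
    using hom that by (auto simp: Hom_def)
  have tail: "finprod (hom_group C S S) (\<lambda>k. \<iota> (Suc k) \<cdot> \<pi> (Suc k)) {..<length As} \<in> Hom C S S"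
    using finprod_Hom[of S S "length As" "\<lambda>k. \<iota> (Suc k) \<cdot> \<pi> (Suc k)"] hom0 ob by auto
  \<comment> \<open>Both sides equal \<open>Id C S\<close>; cancelling the common term identifies
    the tail of the sum with \<open>j \<cdot> q\<close>.\<close>
  have "\<iota> 0 \<cdot> \<pi> 0 \<^bold>+ finprod (hom_group C S S) (\<lambda>k. \<iota> (Suc k) \<cdot> \<pi> (Suc k)) {..<length As} =
      \<iota> 0 \<cdot> \<pi> 0 \<^bold>+ j \<cdot> q"
    using s finprod_lessThan_Suc[of S S "length As" "\<lambda>k. \<iota> k \<cdot> \<pi> k"] hom0 ob b' by simp
  then have "finprod (hom_group C S S) (\<lambda>k. \<iota> (Suc k) \<cdot> \<pi> (Suc k)) {..<length As} \<^bold>+ \<iota> 0 \<cdot> \<pi> 0 =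
      j \<cdot> q \<^bold>+ \<iota> 0 \<cdot> \<pi> 0"
    using tail b'(1-15) by (subst (1 2) Add_commute) (auto simp: Hom_def)
  then have fin: "finprod (hom_group C S S) (\<lambda>k. \<iota> (Suc k) \<cdot> \<pi> (Suc k)) {..<length As} = j \<cdot> q"
    by (rule Add_cancel[of _ _ _ S S]) (use tail b' in \<open>simp_all add: Hom_def\<close>)
  have "finprod (hom_group C T T) (\<lambda>k. I k \<cdot> P k) {..<length As} =
    finprod (hom_group C T T) (\<lambda>k. q \<cdot> ((\<iota> (Suc k) \<cdot> \<pi> (Suc k)) \<cdot> j)) {..<length As}"
  proof -
    interpret G: comm_group "hom_group C T T" using b' by (auto simp: hom_comm_group)
    show ?thesis
      using b' h by (intro G.finprod_cong') (auto simp: hom_group_def I_def P_def)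
  qed
  also have "\<dots> = q \<cdot> ((j \<cdot> q) \<cdot> j)"
    unfolding fin[symmetric]
    by (rule Comp_finprod_Comp[symmetric]) (use b hom0 in \<open>auto simp: biproduct_def\<close>)
  also have "\<dots> = Id C T" using b' by simp
  finally have "finprod (hom_group C T T) (\<lambda>k. I k \<cdot> P k) {..<length As} = Id C T" .
  moreover have "set As \<subseteq> Ob C" "T \<in> Ob C" using ob b' by auto
  ultimately have "direct_sum C As T" unfolding direct_sum_def using IP PI by blast
  moreover have "direct_sum C [A, T] S" using b direct_sum_pair by blast
  ultimately show ?thesis by blast
qed

end

section \<open>Indecomposable summands\<close>

context abelian_category
begin

lemma direct_sum_retract:
  assumes "direct_sum C As S" "A \<in> set As"
  shows "retract A S"
  using assms
proof (induction As arbitrary: S)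
  case (Cons A' As)
  then obtain T where T: "direct_sum C As T" "direct_sum C [A', T] S"
    using direct_sum_ConsD by blast
  then have "retract A' S" "retract T S" using direct_sum_pair biproduct_retract by blast+
  then show ?case using Cons T retract_trans by auto
qed simp

text \<open>With \<open>f\<close> = 0 the identity of \<open>Y\<close> kills \<open>f\<close> and so
  factors through the cokernel \<open>g\<close>. This is the base case for inductions on
  \<open>A\<close>; the dual statement serves those on \<open>B\<close>.\<close>

lemma short_exact_zero_left:
  assumes "short_exact C A f Y g B" "zero_object C A"
  shows "retract Y B"
proof -
  note s = short_exactD[OF assms(1)]
  have "f = Zero C A Y" using assms from_zero_object by (auto simp: short_exact_def)
  then obtain h where "h \<in> Hom C B Y" "h \<cdot> g = Id C Y"
    using cokernel_factor[of g f "Id C Y"] assms(1) s by (auto simp: short_exact_def)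
  then show ?thesis unfolding retract_def using s(4-6) by blast
qed

lemma short_exact_zero_right:
  assumes "short_exact C A f Y g B" "zero_object C B"
  shows "retract Y A \<and> retract A Y"
proof -
  note s = short_exactD[OF assms(1)]
  have "g = Zero C Y B" using assms to_zero_object by (auto simp: short_exact_def)
  then obtain h where h: "h \<in> Hom C Y A" "f \<cdot> h = Id C Y"
    using kernel_factor[OF s(10), of "Id C Y"] s(1-9) by auto
  have "f \<cdot> (h \<cdot> f) = Id C Y \<cdot> f"
    using h s(1-9) by (intro Comp_rewrite) (auto simp: Hom_def)
  also have "\<dots> = f \<cdot> Id C A" using s(1-9) by simp
  finally have "h \<cdot> f = Id C A"
    by (rule kernel_cancel[OF s(10)]) (use h s(1-9) in \<open>auto simp: Hom_def\<close>)
  moreover have "f \<in> Hom C A Y" using s by blast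
  ultimately show ?thesis unfolding retract_def using h by blast
qed

text \<open>The epimorphism is extended by zero to a complement of \<open>A\<close> in
  \<open>S\<close>. The kernel grows by that complement and keeps \<open>Y\<close> as a
  retract.\<close>

lemma short_exact_retract:
  assumes se: "short_exact C Y f A g B" and S: "retract A S"
  shows "\<exists>K k h. short_exact C K k S h B \<and> retract Y K"
proof -
  note s = short_exactD[OF se]
  obtain r t where r: "r \<in> Hom C A S" "t \<in> Hom C S A" "t \<cdot> r = Id C A"
    using S by (auto simp: retract_def)
  then have r': "r \<in> Arr C" "Dom C r = A" "Cod C r = S" "t \<in> Arr C" "Dom C t = S" "Cod C t = A"
    by auto
  have tr: "t \<cdot> (r \<cdot> x) = x" if "x \<in> Arr C" "Cod C x = A" for x
    using retract_cancel[of r t A x] r r' that by simp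
  let ?h = "g \<cdot> t"
  have "?h \<cdot> r = g" using r(3) r' s(1-9) by simp
  then have epi: "epic C ?h" using epic_of_comp[of ?h r] s r' by simp
  obtain k where k: "is_kernel C k ?h" using ex_kernel[of ?h] r' s by auto
  have k': "k \<in> Arr C" "Cod C k = S" "g \<cdot> (t \<cdot> k) = Zero C (Dom C k) B"
    using kernelD[OF k] r' s by simp_all
  obtain u where u: "u \<in> Hom C Y (Dom C k)" "k \<cdot> u = r \<cdot> f"
    using kernel_factor[OF k, of "r \<cdot> f"] r' s tr by auto
  obtain v where v: "v \<in> Hom C (Dom C k) Y" "f \<cdot> v = t \<cdot> k"
    using kernel_factor[OF s(10), of "t \<cdot> k"] r' s k' by auto
  have "f \<cdot> (v \<cdot> u) = t \<cdot> k \<cdot> u"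
    using v u s by (intro Comp_rewrite) (auto simp: Hom_def)
  also have "\<dots> = t \<cdot> (r \<cdot> f)" using u r' k' by (auto simp: Hom_def)
  also have "\<dots> = f \<cdot> Id C Y" using tr s by simp
  finally have "v \<cdot> u = Id C Y"
    by (rule kernel_cancel[OF s(10)]) (use u v s in \<open>simp_all add: Hom_def\<close>)
  then have "retract Y (Dom C k)" using u v by (auto simp: retract_def)
  moreover have "short_exact C (Dom C k) k S ?h B"
    using k epi k' r' s by (auto simp: short_exact_iff)
  ultimately show ?thesis by blast
qed

lemma indecomposable_retract_isomorphic:
  assumes "indecomposable C M" "retract A M" "\<not> zero_object C A"
  shows "isomorphic C A M"
proof -
  obtain i p where i: "i \<in> Hom C A M" "p \<in> Hom C M A" "p \<cdot> i = Id C A"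
    using assms by (auto simp: retract_def)
  then obtain W w q where b: "biproduct A W M i p w q" using retract_biproduct by blast
  note b' = biproductD[OF b]
  have "zero_object C W"
    using assms b direct_sum_pair unfolding indecomposable_def by blast
  then have "w = Zero C W M" using b' by (intro from_zero_object) auto
  then have "i \<cdot> p = Id C M" using b' by simp
  then show ?thesis unfolding isomorphic_def using i by blast
qed

text \<open>If neither term were a unit, their sum, the identity, would be a non-unit.\<close>

lemma local_sum_unit:
  assumes "local_ring (end_ring C Z)" "x \<in> Hom C Z Z" "y \<in> Hom C Z Z" "x \<^bold>+ y = Id C Z"
  shows "\<exists>w \<in> {x, y}. \<exists>v \<in> Hom C Z Z. v \<cdot> w = Id C Z \<and> w \<cdot> v = Id C Z"
proof -
  have "Id C Z \<in> Hom C Z Z" using HomD(4)[OF assms(2)] by (rule Id_closed)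
  then have one: "Id C Z \<in> Units (end_ring C Z)"
    using assms by (auto simp: Units_def end_ring_def intro!: bexI[of _ "Id C Z"])
  have "x \<in> Units (end_ring C Z) \<or> y \<in> Units (end_ring C Z)"
  proof -
    have "x \<in> carrier (end_ring C Z)" "y \<in> carrier (end_ring C Z)" "x \<oplus>\<^bsub>end_ring C Z\<^esub> y = Id C Z"
      using assms by (simp_all add: end_ring_def)
    with one assms(1) show ?thesis unfolding local_ring_def by (metis DiffI)
  qed
  then show ?thesis by (auto simp: Units_def end_ring_def)
qed

lemma local_not_zero_object: "local_ring (end_ring C Z) \<Longrightarrow> \<not> zero_object C Z"
  by (auto simp: local_ring_def end_ring_def zero_object_iff)

text \<open>One of the complementary idempotents \<open>i \<cdot> p\<close> and
  \<open>j \<cdot> q\<close> is a unit. An inverse \<open>v\<close> of the first gives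
  \<open>Id C B = q \<cdot> (i \<cdot> p \<cdot> v) \<cdot> j\<close>, which is zero since
  \<open>q \<cdot> i\<close> is; the other case is symmetric.\<close>

lemma local_indecomposable:
  assumes "Z \<in> Ob C" "local_ring (end_ring C Z)"
  shows "indecomposable C Z"
proof -
  have unit: "zero_object C B"
    if b: "biproduct A B Z i p j q" and v: "v \<in> Hom C Z Z" "i \<cdot> p \<cdot> v = Id C Z" for A B i p j q v
  proof -
    note b' = biproductD[OF b]
    have v': "v \<in> Arr C" "Dom C v = Z" "Cod C v = Z" using v by auto
    have "Id C B = q \<cdot> (Id C Z \<cdot> j)" using b' by simp
    also have "\<dots> = q \<cdot> (i \<cdot> p \<cdot> v \<cdot> j)" unfolding v(2) ..
    also have "\<dots> = Zero C B B" using b'(1-19,21-) v' by simp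
    finally show ?thesis using b' by (simp add: zero_object_iff)
  qed
  have "zero_object C A \<or> zero_object C B" if S: "direct_sum C [A, B] Z" for A B
  proof -
    obtain i p j q where b: "biproduct A B Z i p j q" using S direct_sum_pair by blast
    note b' = biproductD[OF b]
    have "i \<cdot> p \<in> Hom C Z Z" "j \<cdot> q \<in> Hom C Z Z" using b' by auto
    then have "(\<exists>v \<in> Hom C Z Z. i \<cdot> p \<cdot> v = Id C Z) \<or> (\<exists>v \<in> Hom C Z Z. j \<cdot> q \<cdot> v = Id C Z)"
      using local_sum_unit[OF assms(2)] b'(20) by blast
    then show ?thesis using unit[OF b] unit[OF biproduct_swap[OF b]] by blast
  qed
  then show ?thesis using assms local_not_zero_object by (auto simp: indecomposable_def)
qed

text \<open>The identity of \<open>Z\<close> is the sum of its factorisations through the two summands, so one of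
  these is a unit of the local ring \<open>End Z\<close>.\<close>

lemma local_retract_pair:
  assumes Z: "local_ring (end_ring C Z)" "retract Z S" and S: "direct_sum C [A, B] S"
  shows "retract Z A \<or> retract Z B"
proof -
  obtain i p j q where b: "biproduct A B S i p j q" using S direct_sum_pair by blast
  note b' = biproductD[OF b]
  obtain r t where r: "r \<in> Hom C Z S" "t \<in> Hom C S Z" "t \<cdot> r = Id C Z"
    using Z by (auto simp: retract_def)
  then have r': "r \<in> Arr C" "Dom C r = Z" "Cod C r = S" "t \<in> Arr C" "Dom C t = S" "Cod C t = Z"
    by auto
  let ?x = "t \<cdot> (i \<cdot> (p \<cdot> r))" and ?y = "t \<cdot> (j \<cdot> (q \<cdot> r))"
  have xy: "?x \<in> Hom C Z Z" "?y \<in> Hom C Z Z" using r' b' by auto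
  have "?x \<^bold>+ ?y = t \<cdot> (i \<cdot> (p \<cdot> r) \<^bold>+ j \<cdot> (q \<cdot> r))" using r' b' by simp
  also have "\<dots> = Id C Z" using biproduct_decompose[OF b r'(1,3)] r by simp
  finally have "?x \<^bold>+ ?y = Id C Z" .
  then consider v where "v \<in> Hom C Z Z" "v \<cdot> ?x = Id C Z"
    | v where "v \<in> Hom C Z Z" "v \<cdot> ?y = Id C Z"
    using local_sum_unit[OF Z(1) xy] by blast
  then show ?thesis
  proof cases
    case 1
    then have "v \<cdot> (t \<cdot> i) \<cdot> (p \<cdot> r) = Id C Z" using r' b' by (auto simp: Hom_def)
    moreover have "v \<cdot> (t \<cdot> i) \<in> Hom C A Z" "p \<cdot> r \<in> Hom C Z A" using 1 r' b' by (auto simp: Hom_def)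
    ultimately show ?thesis unfolding retract_def by blast
  next
    case 2
    then have "v \<cdot> (t \<cdot> j) \<cdot> (q \<cdot> r) = Id C Z" using r' b' by (auto simp: Hom_def)
    moreover have "v \<cdot> (t \<cdot> j) \<in> Hom C B Z" "q \<cdot> r \<in> Hom C Z B" using 2 r' b' by (auto simp: Hom_def)
    ultimately show ?thesis unfolding retract_def by blast
  qed
qed

end

locale krull_schmidt_category = abelian_category +
  assumes krull_schmidt: "krull_schmidt C"
begin

text \<open>Every term of a decomposition of \<open>M\<close> into objects with local endomorphism
  rings is a nonzero retract of \<open>M\<close>, hence isomorphic to it, and there is a term
  because \<open>M\<close> is nonzero. Passing to an isomorphic copy avoids transporting the ring
  structure to \<open>M\<close>.\<close>

lemma indecomposable_local:
  assumes "indecomposable C M"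
  shows "\<exists>A. isomorphic C A M \<and> local_ring (end_ring C A)"
proof -
  obtain As where As: "direct_sum C As M" "\<forall>A \<in> set As. local_ring (end_ring C A)"
    using krull_schmidt assms unfolding krull_schmidt_def indecomposable_def by blast
  have "As \<noteq> []" using As(1) assms direct_sum_Nil by (auto simp: indecomposable_def)
  then have A: "hd As \<in> set As" by simp
  then have "retract (hd As) M" using As(1) direct_sum_retract by blast
  then show ?thesis
    using A As(2) assms indecomposable_retract_isomorphic local_not_zero_object by blast
qed

lemma indecomposable_decomposition:
  assumes "M \<in> Ob C"
  obtains As where "direct_sum C As M" "\<And>A. A \<in> set As \<Longrightarrow> indecomposable C A \<and> retract A M"
proof -
  obtain As where As: "direct_sum C As M" "\<forall>A \<in> set As. local_ring (end_ring C A)"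
    using krull_schmidt assms unfolding krull_schmidt_def by blast
  moreover have "set As \<subseteq> Ob C" using As(1) by (simp add: direct_sum_def)
  ultimately show thesis using that direct_sum_retract local_indecomposable by blast
qed

text \<open>The part of Krull-Schmidt uniqueness on which closure under direct sums rests. A copy
  \<open>L\<close> of \<open>Z\<close> with local endomorphism ring is a retract of the first term
  or of the rest, and the induction continues in the rest.\<close>

lemma indecomposable_retract_direct_sum:
  assumes Z: "indecomposable C Z"
  shows "retract Z S \<Longrightarrow> direct_sum C As S \<Longrightarrow> \<exists>A \<in> set As. retract Z A"
proof (induction As arbitrary: S)
  case Nil
  then have "zero_object C Z" using direct_sum_Nil retract_zero_object by blast
  then show ?case using Z by (simp add: indecomposable_def)
next
  case (Cons A As)
  obtain L where L: "isomorphic C L Z" "local_ring (end_ring C L)"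
    using indecomposable_local[OF Z] by blast
  obtain T where T: "direct_sum C As T" "direct_sum C [A, T] S"
    using Cons direct_sum_ConsD by blast
  have "retract L S" using L(1) Cons.prems isomorphic_retract retract_trans by blast
  then have "retract L A \<or> retract L T" using local_retract_pair L(2) T(2) by blast
  then have "retract Z A \<or> retract Z T" using L(1) isomorphic_retract retract_trans by blast
  then show ?case using Cons.IH T(1) by auto
qed

section \<open>Additive closures\<close>

text \<open>A test on all indecomposable summands instead of the existence of one decomposition.
  Closure under summands is then transitivity of \<open>retract\<close>, and membership of
  \<open>Y\<close> can be proved one summand at a time, as the definition of \<open>level\<close>
  demands.\<close>

definition indec_span where
  "indec_span L = {M \<in> Ob C. \<forall>Z. indecomposable C Z \<and> retract Z M \<longrightarrow> iso_class C Z \<in> L}"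

lemma indec_span_retract: "M \<in> indec_span L \<Longrightarrow> retract N M \<Longrightarrow> N \<in> indec_span L"
  unfolding indec_span_def using retract_trans retract_Ob by blast

lemma indec_span_direct_sum:
  assumes "direct_sum C As S" "set As \<subseteq> indec_span L"
  shows "S \<in> indec_span L"
  unfolding indec_span_def
proof (intro CollectI conjI allI impI)
  show "S \<in> Ob C" using assms by (simp add: direct_sum_def)
  fix Z assume Z: "indecomposable C Z \<and> retract Z S"
  then obtain A where "A \<in> set As" "retract Z A"
    using assms indecomposable_retract_direct_sum by blast
  then show "iso_class C Z \<in> L" using assms Z unfolding indec_span_def by blast
qed

text \<open>An indecomposable summand of an indecomposable object is isomorphic to it, so only one
  class has to be tested.\<close>

lemma indecomposable_in_indec_span:
  assumes "indecomposable C Z" "iso_class C Z \<in> L" "M \<in> iso_class C Z"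
  shows "M \<in> indec_span L"
  unfolding indec_span_def
proof (intro CollectI conjI allI impI)
  have iso: "isomorphic C Z M" using assms by (simp add: iso_class_def)
  then show "M \<in> Ob C" by (simp add: isomorphic_def)
  fix W assume W: "indecomposable C W \<and> retract W M"
  then have "retract W Z" using iso isomorphic_retract retract_trans by blast
  then have "isomorphic C W Z"
    using W assms(1) indecomposable_retract_isomorphic by (simp add: indecomposable_def)
  then have "iso_class C W = iso_class C Z"
    using iso_class_eq_iff by (auto simp: isomorphic_def)
  then show "iso_class C W \<in> L" using assms by simp
qed

lemma indec_span_decomposition:
  assumes "M \<in> indec_span L"
  obtains As where "direct_sum C As M"
    "\<And>A. A \<in> set As \<Longrightarrow> indecomposable C A \<and> iso_class C A \<in> L"
proof -
  have M: "M \<in> Ob C" "\<And>Z. indecomposable C Z \<Longrightarrow> retract Z M \<Longrightarrow> iso_class C Z \<in> L"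
    using assms by (auto simp: indec_span_def)
  obtain As where "direct_sum C As M" "\<And>A. A \<in> set As \<Longrightarrow> indecomposable C A \<and> retract A M"
    using indecomposable_decomposition[OF M(1)] by blast
  then show thesis using that M(2) by metis
qed

text \<open>The minimality half for both closures, \<open>add_closure\<close> and
  \<open>Res\<close>.\<close>

lemma indec_span_subset:
  assumes "\<Union>L \<subseteq> U" "closed_direct_sums C U"
  shows "indec_span L \<subseteq> U"
proof
  fix M assume "M \<in> indec_span L"
  then obtain As where As: "direct_sum C As M"
    "\<And>A. A \<in> set As \<Longrightarrow> indecomposable C A \<and> iso_class C A \<in> L"
    by (rule indec_span_decomposition) blast
  have "A \<in> iso_class C A" if "A \<in> set As" for A
    using As(2)[OF that] isomorphic_refl by (simp add: iso_class_def indecomposable_def)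
  then have "set As \<subseteq> U" using As(2) assms(1) by blast
  then show "M \<in> U" using As(1) assms(2) unfolding closed_direct_sums_def by blast
qed

lemma indec_span_closed:
  "indec_span L \<subseteq> Ob C" "closed_direct_sums C (indec_span L)" "closed_direct_summands C (indec_span L)"
proof -
  show "indec_span L \<subseteq> Ob C" by (simp add: indec_span_def)
  show "closed_direct_sums C (indec_span L)"
    using indec_span_direct_sum unfolding closed_direct_sums_def by blast
  show "closed_direct_summands C (indec_span L)"
    using indec_span_retract unfolding closed_direct_summands_def direct_summand_iff_retract by blast
qed

lemma Union_subset_indec_span:
  assumes "\<And>c. c \<in> L \<Longrightarrow> \<exists>Z. indecomposable C Z \<and> c = iso_class C Z"
  shows "\<Union>L \<subseteq> indec_span L"
  using assms indecomposable_in_indec_span by blast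

lemma add_closure_eq_indec_span:
  assumes "\<And>c. c \<in> L \<Longrightarrow> \<exists>Z. indecomposable C Z \<and> c = iso_class C Z"
  shows "add_closure C L = indec_span L"
  unfolding add_closure_def
  by (rule Least_equality)
    (use Union_subset_indec_span[OF assms] indec_span_closed[of L] indec_span_subset in auto)

text \<open>An epimorphism onto \<open>P\<close> from a member of \<open>V\<close> splits, which
  makes \<open>P\<close> a direct summand of that member.\<close>

lemma projective_in_resolving:
  assumes "resolving C V" "projective C P"
  shows "P \<in> V"
proof -
  have P: "P \<in> Ob C" using assms by (simp add: projective_def)
  then obtain N f where N: "N \<in> V" "f \<in> Hom C N P" "epic C f"
    using assms unfolding resolving_def quotient_of_def by blast
  have "Id C P \<in> Hom C P (Cod C f)" using HomD(3)[OF N(2)] P by (simp add: Id_closed)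
  then obtain h where "h \<in> Hom C P N" "f \<cdot> h = Id C P"
    using assms N unfolding projective_def by (metis HomD(2))
  then have "retract P N" using N by (auto simp: retract_def)
  then show ?thesis
    using assms N direct_summand_iff_retract unfolding resolving_def closed_direct_summands_def by blast
qed

end

section \<open>The resolving closure\<close>

locale indec_generators = krull_schmidt_category +
  fixes \<X>
  assumes \<X>: "\<X> \<subseteq> nonproj_indec C (Ob C)"
begin

definition levels where "levels = (\<Union>i. level C \<X> i)"

lemma level_mono: "i \<le> j \<Longrightarrow> level C \<X> i \<subseteq> level C \<X> j"
  by (rule lift_Suc_mono_le[of "level C \<X>"]) auto

lemma level_indecomposable:
  "c \<in> level C \<X> i \<Longrightarrow> \<exists>Z. indecomposable C Z \<and> c = iso_class C Z"
  using \<X> by (induction i) (auto simp: nonproj_indec_def)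

lemma levels_indecomposable: "c \<in> levels \<Longrightarrow> \<exists>Z. indecomposable C Z \<and> c = iso_class C Z"
  using level_indecomposable by (auto simp: levels_def)

text \<open>Each step from \<open>i\<close> to \<open>Suc i\<close> takes all its data from one
  level; since the levels increase, finitely many classes always share one.\<close>

lemma levels_common_bound:
  assumes "\<And>A. A \<in> set As \<Longrightarrow> iso_class C A \<in> levels"
  shows "\<exists>i. \<forall>A \<in> set As. iso_class C A \<in> level C \<X> i"
  using assms
proof (induction As)
  case (Cons A As)
  then obtain i j where "\<forall>A \<in> set As. iso_class C A \<in> level C \<X> i" "iso_class C A \<in> level C \<X> j"
    by (force simp: levels_def)
  then have "\<forall>A \<in> set (A # As). iso_class C A \<in> level C \<X> (max i j)"
    using level_mono[of i "max i j"] level_mono[of j "max i j"] by auto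
  then show ?case by blast
qed simp

section \<open>Closure properties of the span of all levels\<close>

abbreviation "\<E> \<equiv> indec_span levels"

lemma projective_in_span:
  assumes "projective C P"
  shows "P \<in> \<E>"
  unfolding indec_span_def
proof (intro CollectI conjI allI impI)
  show "P \<in> Ob C" using assms by (simp add: projective_def)
  fix Z assume Z: "indecomposable C Z \<and> retract Z P"
  then have "iso_class C Z \<in> level C \<X> 0" using assms projective_retract by auto
  then show "iso_class C Z \<in> levels" unfolding levels_def by blast
qed

lemma extension_indecomposables:
  assumes "short_exact C A f Y g B" "iso_class C A \<in> levels" "iso_class C B \<in> levels"
  shows "Y \<in> \<E>"
  unfolding indec_span_def
proof (intro CollectI conjI allI impI)
  show "Y \<in> Ob C" using short_exactD(8) assms(1) by blast
  fix Z assume Z: "indecomposable C Z \<and> retract Z Y"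
  obtain i where "iso_class C A \<in> level C \<X> i" "iso_class C B \<in> level C \<X> i"
    using levels_common_bound[of "[A, B]"] assms by auto
  then have "iso_class C Z \<in> level C \<X> (Suc i)"
    using Z assms(1) direct_summand_iff_retract by auto
  then show "iso_class C Z \<in> levels" unfolding levels_def by blast
qed

text \<open>Adding two copies of \<open>B\<close> to \<open>A\<close>, on which the epimorphism is zero, ensures that the middle
  term has at least two summands.\<close>

lemma kernel_onto_indecomposable:
  assumes se: "short_exact C Y f A g B" and A: "A \<in> \<E>" and B: "iso_class C B \<in> levels"
  shows "Y \<in> \<E>"
proof -
  obtain As where As: "direct_sum C As A"
    "\<And>A. A \<in> set As \<Longrightarrow> indecomposable C A \<and> iso_class C A \<in> levels"
    using A by (rule indec_span_decomposition) blast
  have ob: "A \<in> Ob C" "B \<in> Ob C" using short_exactD[OF se] by auto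
  obtain S' where S': "direct_sum C [B, A] S'" using ex_direct_sum ob by blast
  have "S' \<in> Ob C" using S' by (simp add: direct_sum_def)
  then obtain S where S: "direct_sum C [B, S'] S" using ex_direct_sum ob by blast
  have sum: "direct_sum C (B # B # As) S"
    using S S' As(1) direct_sum_ConsI by blast
  have "retract A S"
    using retract_trans[OF direct_sum_retract[OF S', of A] direct_sum_retract[OF S, of S']] by simp
  then obtain K k h where K: "short_exact C K k S h B" "retract Y K"
    using short_exact_retract[OF se] by blast
  obtain i where i: "\<forall>A' \<in> set (B # B # As). iso_class C A' \<in> level C \<X> i"
    using levels_common_bound[of "B # B # As"] As(2) B by auto
  have "K \<in> \<E>"
    unfolding indec_span_def
  proof (intro CollectI conjI allI impI)
    show "K \<in> Ob C" using short_exactD(7) K(1) by blast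
    fix Z assume Z: "indecomposable C Z \<and> retract Z K"
    have "\<exists>p\<ge>1. \<exists>As S f g B'. length As = p + 1 \<and> direct_sum C As S \<and> short_exact C K f S g B' \<and>
        (\<forall>A \<in> set As. iso_class C A \<in> level C \<X> i) \<and> iso_class C B' \<in> level C \<X> i"
      \<comment> \<open>The terms are numbered from 0 to \<open>p\<close>, so \<open>p\<close> is
        one less than the length of \<open>B # B # As\<close>.\<close>
      by (intro exI[of _ "Suc (length As)"] conjI exI[of _ "B # B # As"] exI[of _ S] exI[of _ k]
          exI[of _ h] exI[of _ B]) (use sum K(1) i in auto)
    moreover have "direct_summand C Z K" using Z direct_summand_iff_retract by blast
    ultimately have "iso_class C Z \<in> level C \<X> (Suc i)"
      using Z unfolding level.simps by blast
    then show "iso_class C Z \<in> levels" unfolding levels_def by blast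
  qed
  then show ?thesis using K(2) indec_span_retract by blast
qed

text \<open>\<open>A\<close> stays fixed while \<open>Y\<close> and \<open>B\<close> vary. The
  intermediate \<open>X\<close> is the kernel of an epimorphism from \<open>A\<close> onto the
  shorter sum \<open>T\<close>, so the induction hypothesis puts it in the span; \<open>Y\<close> is
  then a kernel of an epimorphism from \<open>X\<close> onto the single term
  \<open>B'\<close>.\<close>

lemma kernel_in_span:
  assumes "short_exact C Y f A g B" "A \<in> \<E>" "B \<in> \<E>"
  shows "Y \<in> \<E>"
proof -
  obtain Bs where "direct_sum C Bs B" "\<And>B. B \<in> set Bs \<Longrightarrow> iso_class C B \<in> levels"
    using assms(3) by (rule indec_span_decomposition) blast
  then show ?thesis using assms(1)
  proof (induction Bs arbitrary: B f g Y)
    case Nil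
    then have "retract Y A" using short_exact_zero_right direct_sum_Nil by blast
    then show ?case using assms(2) indec_span_retract by blast
  next
    case (Cons B' Bs)
    obtain T where T: "direct_sum C Bs T" "direct_sum C [B', T] B"
      using Cons.prems direct_sum_ConsD by blast
    obtain X f1 g1 f2 g2 where "short_exact C Y f1 X g1 B'" "short_exact C X f2 A g2 T"
      using short_exact_split_right[OF Cons.prems(3) T(2)] by blast
    then show ?case
      using Cons.IH[OF T(1)] Cons.prems(2) kernel_onto_indecomposable by auto
  qed
qed

text \<open>\<open>B\<close> stays fixed. \<open>Y1\<close> is covered by step (a),
  \<open>Y2\<close> by the induction hypothesis, and \<open>Y\<close> is the kernel of an
  epimorphism from their sum onto \<open>B\<close>.\<close>

lemma extension_of_indecomposable:
  assumes "short_exact C A f Y g B" "A \<in> \<E>" "B \<in> \<E>" "iso_class C B \<in> levels"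
  shows "Y \<in> \<E>"
proof -
  obtain As where "direct_sum C As A" "\<And>A. A \<in> set As \<Longrightarrow> iso_class C A \<in> levels"
    using assms(2) by (rule indec_span_decomposition) blast
  then show ?thesis using assms(1)
  proof (induction As arbitrary: A f g Y)
    case Nil
    then have "retract Y B" using short_exact_zero_left direct_sum_Nil by blast
    then show ?case using assms(3) indec_span_retract by blast
  next
    case (Cons A' As)
    obtain T where T: "direct_sum C As T" "direct_sum C [A', T] A"
      using Cons.prems direct_sum_ConsD by blast
    obtain Y1 f1 g1 Y2 f2 g2 S k h where Y: "short_exact C A' f1 Y1 g1 B" "short_exact C T f2 Y2 g2 B"
      "direct_sum C [Y1, Y2] S" "short_exact C Y k S h B"
      using short_exact_split_left[OF Cons.prems(3) T(2)] by blast
    have "Y1 \<in> \<E>" using extension_indecomposables Y(1) Cons.prems(2) assms(4) by auto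
    moreover have "Y2 \<in> \<E>" using Cons.IH[OF T(1) _ Y(2)] Cons.prems(2) by auto
    ultimately have "S \<in> \<E>" using indec_span_direct_sum[OF Y(3)] by simp
    then show ?case using kernel_in_span Y(4) assms(3) by blast
  qed
qed

text \<open>The induction must range over all \<open>A\<close> in the span: \<open>X\<close>, an
  extension of the single term \<open>B'\<close> by \<open>A\<close>, takes the place of
  \<open>A\<close> when the rest \<open>T\<close> is treated.\<close>

lemma extension_in_span:
  assumes "short_exact C A f Y g B" "A \<in> \<E>" "B \<in> \<E>"
  shows "Y \<in> \<E>"
proof -
  obtain Bs where "direct_sum C Bs B" "\<And>B. B \<in> set Bs \<Longrightarrow> indecomposable C B \<and> iso_class C B \<in> levels"
    using assms(3) by (rule indec_span_decomposition) blast
  then show ?thesis using assms(1,2)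
  proof (induction Bs arbitrary: A f Y g B)
    case Nil
    then have "retract Y A" using short_exact_zero_right direct_sum_Nil by blast
    then show ?case using Nil indec_span_retract by blast
  next
    case (Cons B' Bs)
    obtain T where T: "direct_sum C Bs T" "direct_sum C [B', T] B"
      using Cons.prems direct_sum_ConsD by blast
    obtain X f1 g1 f2 g2 where X: "short_exact C A f1 X g1 B'" "short_exact C X f2 Y g2 T"
      using short_exact_split_right[OF Cons.prems(3) T(2)] by blast
    have B': "indecomposable C B'" "iso_class C B' \<in> levels" using Cons.prems(2) by auto
    then have "B' \<in> \<E>"
      using indecomposable_in_indec_span isomorphic_refl
      by (auto simp: iso_class_def indecomposable_def)
    then have "X \<in> \<E>" using extension_of_indecomposable X(1) Cons.prems(4) B' by blast
    then show ?case using Cons.IH[OF T(1) _ X(2)] Cons.prems(2) by auto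
  qed
qed

lemma resolving_span:
  assumes "enough_projectives C"
  shows "resolving C \<E>"
proof -
  have "\<forall>M \<in> Ob C. \<exists>N \<in> \<E>. quotient_of C M N"
    using assms projective_in_span unfolding enough_projectives_def by blast
  moreover have "closed_extensions C \<E>"
    using extension_in_span unfolding closed_extensions_def by blast
  moreover have "closed_kernels_of_epis C \<E>"
    unfolding closed_kernels_of_epis_def
  proof (intro allI impI)
    fix k f
    assume a: "epic C f \<and> Dom C f \<in> \<E> \<and> Cod C f \<in> \<E> \<and> is_kernel C k f"
    then have "short_exact C (Dom C k) k (Dom C f) f (Cod C f)"
      using kernelD[of k f] by (auto simp: short_exact_iff)
    then show "Dom C k \<in> \<E>" using a kernel_in_span by blast
  qed
  ultimately show ?thesis using indec_span_closed[of levels] by (simp add: resolving_def)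
qed

text \<open>A resolving subcategory is closed under both steps. As classes are sets of objects,
  every object isomorphic to a summand must be reached too; it is itself a retract.\<close>

lemma level_subset_resolving:
  assumes V: "resolving C V" "\<Union>\<X> \<subseteq> V"
  shows "\<Union>(level C \<X> i) \<subseteq> V"
proof (induction i)
  case 0
  have "M \<in> V" if "projective C P" "M \<in> iso_class C P" for M P
  proof -
    have "retract M P" using that isomorphic_retract by (simp add: iso_class_def)
    then show ?thesis using projective_retract projective_in_resolving V(1) that(1) by blast
  qed
  then show ?case using V(2) by auto
next
  case (Suc i)
  have mem: "A \<in> V" if "A \<in> Ob C" "iso_class C A \<in> level C \<X> i" for A
    using Suc that isomorphic_refl[of A] by (auto simp: iso_class_def)
  have summand: "M \<in> V" if "M \<in> iso_class C Z" "direct_summand C Z Y" "Y \<in> V" for M Z Y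
  proof -
    have "retract M Y"
      using that isomorphic_retract retract_trans direct_summand_iff_retract
      unfolding iso_class_def by blast
    then show ?thesis
      using V(1) that(3) direct_summand_iff_retract
      unfolding resolving_def closed_direct_summands_def by blast
  qed
  have ext: "Y \<in> V" if "short_exact C A f Y g B" "iso_class C A \<in> level C \<X> i"
    "iso_class C B \<in> level C \<X> i" for A f Y g B
    using V(1) that mem short_exactD(7,9)[OF that(1)]
    unfolding resolving_def closed_extensions_def by blast
  have ker: "Y \<in> V" if As: "direct_sum C As S" "\<forall>A \<in> set As. iso_class C A \<in> level C \<X> i"
    and se: "short_exact C Y f S g B" and B: "iso_class C B \<in> level C \<X> i" for As S Y f g B
  proof -
    note s = short_exactD[OF se]
    have "set As \<subseteq> V" using As mem by (auto simp: direct_sum_def)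
    then have "S \<in> V" using V(1) As(1) unfolding resolving_def closed_direct_sums_def by blast
    moreover have "B \<in> V" using mem B s(9) by blast
    ultimately show ?thesis
      using V(1) s(2,5,6,10,11) unfolding resolving_def closed_kernels_of_epis_def by metis
  qed
  show ?case
    using Suc summand ext ker by (simp only: level.simps) blast
qed

lemma Res_eq_span:
  assumes "enough_projectives C"
  shows "Res C \<X> = \<E>"
  unfolding Res_def
proof (rule Least_equality)
  have "\<X> \<subseteq> level C \<X> 0" by simp
  then have "\<Union>\<X> \<subseteq> \<Union>levels" unfolding levels_def by blast
  then show "resolving C \<E> \<and> \<Union>\<X> \<subseteq> \<E>"
    using Union_subset_indec_span levels_indecomposable resolving_span[OF assms] by blast
  fix V assume V: "resolving C V \<and> \<Union>\<X> \<subseteq> V"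
  then have "\<Union>levels \<subseteq> V" using level_subset_resolving unfolding levels_def by blast
  then show "\<E> \<le> V" using indec_span_subset V by (simp add: resolving_def)
qed

text \<open>Projectivity is invariant under isomorphism, so whether a class belongs to
  \<open>proj C\<close> can be read off any representative.\<close>

lemma nonproj_indec_span: "nonproj_indec C \<E> = levels - proj C"
proof (intro equalityI subsetI)
  fix c assume "c \<in> nonproj_indec C \<E>"
  then obtain M where M: "M \<in> \<E>" "indecomposable C M" "\<not> projective C M" "c = iso_class C M"
    by (auto simp: nonproj_indec_def)
  then have M': "M \<in> Ob C" by (simp add: indecomposable_def)
  then have "c \<in> levels" using M retract_refl by (simp add: indec_span_def)
  moreover have "c \<notin> proj C"
  proof
    assume "c \<in> proj C"
    then obtain P where P: "projective C P" "iso_class C M = iso_class C P"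
      using M(4) by (auto simp: proj_def)
    then have "isomorphic C M P" using iso_class_eq_iff M' by (simp add: projective_def)
    then show False using M(3) P(1) projective_retract isomorphic_retract by blast
  qed
  ultimately show "c \<in> levels - proj C" by blast
next
  fix c assume c: "c \<in> levels - proj C"
  then obtain Z where Z: "indecomposable C Z" "c = iso_class C Z"
    using levels_indecomposable by blast
  then have "Z \<in> iso_class C Z" using isomorphic_refl by (simp add: iso_class_def indecomposable_def)
  then have "Z \<in> \<E>" using indecomposable_in_indec_span Z c by blast
  moreover have "\<not> projective C Z" using Z c by (auto simp: proj_def)
  ultimately show "c \<in> nonproj_indec C \<E>" using Z by (auto simp: nonproj_indec_def)
qed

end

theorem theorem2p15:
  fixes C :: "('o, 'm) precat" and \<X> :: "'o set set"
  assumes "abelian_category C"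
    and "krull_schmidt C"
    and "enough_projectives C"
    and "\<X> \<subseteq> nonproj_indec C (Ob C)"
  shows "Res C \<X> = add_closure C (\<Union>i. level C \<X> i) \<and>
         nonproj_indec C (Res C \<X>) = (\<Union>i. level C \<X> i) - proj C"
proof -
  interpret abelian_category C by fact
  interpret indec_generators C \<X> by unfold_locales (use assms in auto)
  show ?thesis
    unfolding levels_def[symmetric]
    using Res_eq_span[OF assms(3)] add_closure_eq_indec_span[OF levels_indecomposable]
      nonproj_indec_span
    by simp
qed

end
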